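(* Let $\Gamma=(V,E)$ be a finite simple graph which is non-empty (i.e. $E\neq\emptyset$) and transposition-free. Then the group $A(\Gamma)$ has $R_\infty$-nilpotency index equal to $2$.
   Context: A graph $\Gamma=(V,E)$ consists of a finite set $V$ and a set $E\subseteq\{\{v,w\}\mid v,w\in V, v\neq w\}$. It is transposition-free if for no two distinct vertices $v,w\in V$ the transposition of $v$ and $w$ (fixing all other vertices) is a graph automorphism of $\Gamma$. The right-angled Artin group is defined with the convention that NON-adjacent vertices commute: $A(\Gamma)=\langle V\mid [v,w];\ v,w\in V,\ \{v,w\}\notin E\rangle$. For a group $G$ and $\varphi\in\mathrm{Aut}(G)$, elements $x,y\in G$ are $\varphi$-conjugate if $x=zy\varphi(z)^{-1}$ for some $z\in G$; the Reidemeister number $R(\varphi)\in\{1,2,3,\dots\}\cup\{\infty\}$ is the number of $\varphi$-conjugacy classes. $G$ has the $R_\infty$-property if $R(\varphi)=\infty$ for every $\varphi\in\mathrm{Aut}(G)$. The lower central series is $\gamma_1(G)=G$, $\gamma_{i+1}(G)=[G,\gamma_i(G)]$. The $R_\infty$-nilpotency index of $G$ is the least integer $c$ such that $G/\gamma_{c+1}(G)$ has the $R_\infty$-property (infinite if no such integer exists). *)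

theory Defs
  imports
    "HOL-Algebra.Bij"
    "HOL-Algebra.Generated_Groups"
    "HOL-Combinatorics.Transposition"
    "HOL-Library.Extended_Nat"
begin

section \<open>Graphs\<close>

definition simple_graph :: "'a set \<Rightarrow> 'a set set \<Rightarrow> bool" where
  "simple_graph V E \<longleftrightarrow> finite V \<and> E \<subseteq> {{v, w} | v w. v \<in> V \<and> w \<in> V \<and> v \<noteq> w}"

definition graph_automorphism :: "'a set \<Rightarrow> 'a set set \<Rightarrow> ('a \<Rightarrow> 'a) \<Rightarrow> bool" where
  "graph_automorphism V E f \<longleftrightarrow>
     bij_betw f V V \<and> (\<forall>x\<in>V. \<forall>y\<in>V. {x, y} \<in> E \<longleftrightarrow> {f x, f y} \<in> E)"

definition transposition_free :: "'a set \<Rightarrow> 'a set set \<Rightarrow> bool" where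
  "transposition_free V E \<longleftrightarrow>
     (\<forall>v\<in>V. \<forall>w\<in>V. v \<noteq> w \<longrightarrow> \<not> graph_automorphism V E (transpose v w))"


section \<open>Groups given by generators and relators\<close>

text \<open>
  A letter \<open>(s, True)\<close> stands for the generator \<open>s\<close>, and \<open>(s, False)\<close> for its inverse.
  The group \<open>\<langle>S | R\<rangle>\<close> consists of the words over these letters modulo insertion and deletion of
  subwords \<open>s s\<^sup>-\<^sup>1\<close>, \<open>s\<^sup>-\<^sup>1 s\<close> and of relators.
\<close>

type_synonym 'a word = "('a \<times> bool) list"

definition words :: "'a set \<Rightarrow> 'a word set" where
  "words S = lists (S \<times> UNIV)"

inductive word_eq :: "'a set \<Rightarrow> 'a word set \<Rightarrow> 'a word \<Rightarrow> 'a word \<Rightarrow> bool"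
  for S :: "'a set" and R :: "'a word set" where
  refl: "w \<in> words S \<Longrightarrow> word_eq S R w w"
| sym: "word_eq S R u v \<Longrightarrow> word_eq S R v u"
| trans: "word_eq S R u v \<Longrightarrow> word_eq S R v w \<Longrightarrow> word_eq S R u w"
| cancel: "s \<in> S \<Longrightarrow> u \<in> words S \<Longrightarrow> v \<in> words S \<Longrightarrow>
    word_eq S R (u @ [(s, b), (s, \<not> b)] @ v) (u @ v)"
| relator: "r \<in> R \<Longrightarrow> r \<in> words S \<Longrightarrow> u \<in> words S \<Longrightarrow> v \<in> words S \<Longrightarrow>
    word_eq S R (u @ r @ v) (u @ v)"

definition word_rel :: "'a set \<Rightarrow> 'a word set \<Rightarrow> ('a word \<times> 'a word) set" where
  "word_rel S R = {(u, v). word_eq S R u v}"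

definition word_class :: "'a set \<Rightarrow> 'a word set \<Rightarrow> 'a word \<Rightarrow> 'a word set" where
  "word_class S R w = word_rel S R `` {w}"

definition presented_group :: "'a set \<Rightarrow> 'a word set \<Rightarrow> 'a word set monoid" where
  "presented_group S R =
    \<lparr>carrier = words S // word_rel S R,
     monoid.mult = (\<lambda>A B. \<Union>x\<in>A. \<Union>y\<in>B. word_class S R (x @ y)),
     one = word_class S R []\<rparr>"

lemma words_simps [simp]:
  "[] \<in> words S"
  "x # w \<in> words S \<longleftrightarrow> fst x \<in> S \<and> w \<in> words S"
  "u @ v \<in> words S \<longleftrightarrow> u \<in> words S \<and> v \<in> words S"
  by (cases x; auto simp: words_def)+

lemma word_eq_words: "word_eq S R u v \<Longrightarrow> u \<in> words S \<and> v \<in> words S"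
  by (induction rule: word_eq.induct) auto

lemma equiv_word_rel: "equiv (words S) (word_rel S R)"
proof (rule equivI)
  show "word_rel S R \<subseteq> words S \<times> words S"
    by (auto simp: word_rel_def dest: word_eq_words)
  show "refl_on (words S) (word_rel S R)"
    by (auto simp: word_rel_def refl_on_def intro: word_eq.refl)
  show "sym (word_rel S R)"
    unfolding word_rel_def sym_def using word_eq.sym by blast
  show "trans (word_rel S R)"
    unfolding word_rel_def trans_def using word_eq.trans by blast
qed

lemma word_eq_append_left: "word_eq S R u v \<Longrightarrow> w \<in> words S \<Longrightarrow> word_eq S R (w @ u) (w @ v)"
proof (induction rule: word_eq.induct)
  case (cancel s u v b)
  then show ?case using word_eq.cancel[of s S "w @ u" v R b] by simp
next
  case (relator r u v)
  then show ?case using word_eq.relator[of r R S "w @ u" v] by simp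
next
  case (sym u v)
  then show ?case using word_eq.sym by blast
next
  case (trans u v z)
  then show ?case using word_eq.trans by blast
qed (simp add: word_eq.refl)

lemma word_eq_append_right: "word_eq S R u v \<Longrightarrow> w \<in> words S \<Longrightarrow> word_eq S R (u @ w) (v @ w)"
proof (induction rule: word_eq.induct)
  case (cancel s u v b)
  then show ?case using word_eq.cancel[of s S u "v @ w" R b] by simp
next
  case (relator r u v)
  then show ?case using word_eq.relator[of r R S u "v @ w"] by simp
next
  case (sym u v)
  then show ?case using word_eq.sym by blast
next
  case (trans u v z)
  then show ?case using word_eq.trans by blast
qed (simp add: word_eq.refl)

lemma word_eq_append:
  "word_eq S R u u' \<Longrightarrow> word_eq S R v v' \<Longrightarrow> word_eq S R (u @ v) (u' @ v')"
  by (meson word_eq.trans word_eq_append_left word_eq_append_right word_eq_words)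

lemma word_class_eq_iff:
  "u \<in> words S \<Longrightarrow> v \<in> words S \<Longrightarrow> word_class S R u = word_class S R v \<longleftrightarrow> word_eq S R u v"
  using eq_equiv_class_iff[OF equiv_word_rel, of u S v R]
  unfolding word_class_def by (simp add: word_rel_def)

lemma carrier_presented_group: "carrier (presented_group S R) = word_class S R ` words S"
  by (auto simp: presented_group_def quotient_def word_class_def)

lemma one_presented_group: "\<one>\<^bsub>presented_group S R\<^esub> = word_class S R []"
  by (simp add: presented_group_def word_class_def)

lemma mult_presented_group:
  assumes "u \<in> words S" "v \<in> words S"
  shows "word_class S R u \<otimes>\<^bsub>presented_group S R\<^esub> word_class S R v = word_class S R (u @ v)"
proof -
  have "word_class S R (x @ y) = word_class S R (u @ v)"
    if "x \<in> word_class S R u" "y \<in> word_class S R v" for x y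
  proof -
    have *: "word_eq S R u x" "word_eq S R v y"
      using that by (simp_all add: word_class_def word_rel_def)
    then have "x \<in> words S" "y \<in> words S"
      using word_eq_words by blast+
    then show ?thesis
      using word_class_eq_iff[of "u @ v" S "x @ y" R] word_eq_append[OF *] assms by simp
  qed
  then have "(\<Union>x\<in>word_class S R u. \<Union>y\<in>word_class S R v. word_class S R (x @ y)) =
      (\<Union>x\<in>word_class S R u. \<Union>y\<in>word_class S R v. word_class S R (u @ v))"
    by (intro SUP_cong HOL.refl)
  moreover have "u \<in> word_class S R u" "v \<in> word_class S R v"
    using assms by (simp_all add: word_class_def word_rel_def word_eq.refl)
  then have "(\<Union>x\<in>word_class S R u. \<Union>y\<in>word_class S R v. word_class S R (u @ v)) =
      word_class S R (u @ v)"
    by blast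
  ultimately show ?thesis
    by (simp add: presented_group_def)
qed

definition word_inverse :: "'a word \<Rightarrow> 'a word" where
  "word_inverse w = rev (map (\<lambda>(s, b). (s, \<not> b)) w)"

lemma word_inverse_words [simp]: "w \<in> words S \<Longrightarrow> word_inverse w \<in> words S"
  by (auto simp: word_inverse_def words_def)

lemma word_eq_inverse: "w \<in> words S \<Longrightarrow> word_eq S R (word_inverse w @ w) []"
proof (induction w)
  case Nil
  show ?case by (simp add: word_inverse_def word_eq.refl)
next
  case (Cons x w)
  obtain s b where x: "x = (s, b)" by (cases x)
  have "word_eq S R (word_inverse w @ [(s, \<not> b), (s, \<not> \<not> b)] @ w) (word_inverse w @ w)"
    using Cons.prems x by (intro word_eq.cancel) auto
  moreover have "word_inverse (x # w) @ x # w = word_inverse w @ [(s, \<not> b), (s, \<not> \<not> b)] @ w"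
    by (simp add: word_inverse_def x)
  ultimately show ?case
    using Cons by (metis word_eq.trans words_simps(2))
qed

lemma group_presented_group: "group (presented_group S R)"
proof (rule groupI)
  fix x assume "x \<in> carrier (presented_group S R)"
  then obtain u where u: "u \<in> words S" "x = word_class S R u"
    by (auto simp: carrier_presented_group)
  then have "word_class S R (word_inverse u) \<otimes>\<^bsub>presented_group S R\<^esub> x = \<one>\<^bsub>presented_group S R\<^esub>"
    by (simp add: mult_presented_group one_presented_group word_class_eq_iff word_eq_inverse)
  then show "\<exists>y\<in>carrier (presented_group S R). y \<otimes>\<^bsub>presented_group S R\<^esub> x = \<one>\<^bsub>presented_group S R\<^esub>"
    using u by (auto simp: carrier_presented_group)
qed (auto simp: carrier_presented_group one_presented_group mult_presented_group)


section \<open>Right-angled Artin groups\<close>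

text \<open>Non-adjacent vertices commute.\<close>

definition raag :: "'a set \<Rightarrow> 'a set set \<Rightarrow> 'a word set monoid" where
  "raag V E = presented_group V
     {[(v, True), (w, True), (v, False), (w, False)] | v w. v \<in> V \<and> w \<in> V \<and> {v, w} \<notin> E}"

lemma group_raag: "group (raag V E)"
  by (simp add: raag_def group_presented_group)


section \<open>Twisted conjugacy\<close>

definition twisted_conj :: "('g, 'b) monoid_scheme \<Rightarrow> ('g \<Rightarrow> 'g) \<Rightarrow> ('g \<times> 'g) set" where
  "twisted_conj G \<phi> =
    {(x, y). x \<in> carrier G \<and> y \<in> carrier G \<and>
       (\<exists>z\<in>carrier G. x = z \<otimes>\<^bsub>G\<^esub> y \<otimes>\<^bsub>G\<^esub> inv\<^bsub>G\<^esub> (\<phi> z))}"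

definition reidemeister_number :: "('g, 'b) monoid_scheme \<Rightarrow> ('g \<Rightarrow> 'g) \<Rightarrow> enat" where
  "reidemeister_number G \<phi> =
    (if finite (carrier G // twisted_conj G \<phi>)
     then enat (card (carrier G // twisted_conj G \<phi>)) else \<infinity>)"

definition R_infinity :: "('g, 'b) monoid_scheme \<Rightarrow> bool" where
  "R_infinity G \<longleftrightarrow> (\<forall>\<phi>\<in>auto G. reidemeister_number G \<phi> = \<infinity>)"


section \<open>Lower central series and nilpotency index\<close>

text \<open>The series starts at index 1; the value at index 0 is a dummy.\<close>

fun lower_central :: "('g, 'b) monoid_scheme \<Rightarrow> nat \<Rightarrow> 'g set" where
  "lower_central G 0 = carrier G"
| "lower_central G (Suc 0) = carrier G"
| "lower_central G (Suc (Suc i)) =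
     generate G {x \<otimes>\<^bsub>G\<^esub> y \<otimes>\<^bsub>G\<^esub> inv\<^bsub>G\<^esub> x \<otimes>\<^bsub>G\<^esub> inv\<^bsub>G\<^esub> y |
       x y. x \<in> carrier G \<and> y \<in> lower_central G (Suc i)}"

text \<open>The infimum in \<^typ>\<open>enat\<close> is \<open>\<infinity>\<close> if there is no such \<open>c\<close>.\<close>

definition R_infinity_nilpotency_index :: "('g, 'b) monoid_scheme \<Rightarrow> enat" where
  "R_infinity_nilpotency_index G =
     (INF c\<in>{c. R_infinity (G Mod lower_central G (c + 1))}. enat c)"

end

theory Submission
  imports
    Defs
    "HOL-Algebra.FiniteProduct"
    "HOL-Combinatorics.Cycles"
    "HOL-Computational_Algebra.Primes"
begin

text \<open>
  With \<open>G = A(\<Gamma>)\<close>, the quotients \<open>G/\<gamma>\<^sub>1(G)\<close> and \<open>G/\<gamma>\<^sub>2(G)\<close> are finitely generated abelian, so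
  inversion has finite Reidemeister number on them.
  Let \<open>\<phi>\<close> be an automorphism of \<open>G/\<gamma>\<^sub>3(G)\<close> and \<open>A\<close> its integer matrix on the abelianization
  \<open>\<int>\<^sup>V\<close>. The centralizer of a vector whose support contains the vertex \<open>u\<close> has corank at least the
  degree of \<open>u\<close>. Since \<open>A\<close> preserves centralizers, it is block triangular with respect to the degree,
  and in a transposition-free graph the diagonal blocks are monomial: \<open>A\<close> is a signed permutation
  \<open>\<theta>\<close> of the vertices plus terms of lower degree, and \<open>\<theta>\<close> is a graph automorphism. If the
  product of the signs along some \<open>\<theta>\<close>-orbit of vertices is \<open>1\<close>, then \<open>A\<close> fixes a nonzero
  functional, which separates infinitely many twisted conjugacy classes. Otherwise \<open>A\<close> has no
  nonzero fixed vector. Comparing the 2-adic valuations of the orbit lengths then yields an orbit of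
  edges with sign \<open>1\<close> (a vertex with maximal valuation and its image half an orbit further are adjacent
  or are distinguished by a third vertex), hence a nonzero invariant functional on
  \<open>\<gamma>\<^sub>2(G)/\<gamma>\<^sub>3(G)\<close>, which separates infinitely many classes of central elements.
\<close>

section \<open>Integer linear systems with more unknowns than equations\<close>

text \<open>Fraction-free Gaussian elimination: a pivot \<open>M k i\<close> removes the unknown
  \<open>i\<close> from the other equations by cross multiplication, so solutions stay
  integral.\<close>

lemma homogeneous_system_nontrivial:
  fixes M :: "'k \<Rightarrow> 'j \<Rightarrow> int"
  assumes "finite K" "finite J" "card K < card J"
  shows "\<exists>c. (\<exists>j\<in>J. c j \<noteq> 0) \<and> (\<forall>k\<in>K. (\<Sum>j\<in>J. M k j * c j) = 0)"
  using assms
proof (induction K arbitrary: J M rule: finite_induct)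
  case empty
  then have "J \<noteq> {}" by auto
  then show ?case by (intro exI[of _ "\<lambda>_. 1"]) auto
next
  case (insert k K)
  show ?case
  proof (cases "\<forall>j\<in>J. M k j = 0")
    case True
    then show ?thesis
      using insert.IH[of J M] insert.prems insert.hyps by auto
  next
    case False
    then obtain i where i: "i \<in> J" "M k i \<noteq> 0" by blast
    define J' where "J' = J - {i}"
    have J': "finite J'" "J = insert i J'" "i \<notin> J'" "card K < card J'"
      using i insert.prems insert.hyps by (auto simp: J'_def)
    obtain c where c: "\<exists>j\<in>J'. c j \<noteq> 0"
      "\<And>l. l \<in> K \<Longrightarrow> (\<Sum>j\<in>J'. (M k i * M l j - M l i * M k j) * c j) = 0"
      using insert.IH[OF J'(1,4), of "\<lambda>l j. M k i * M l j - M l i * M k j"] by auto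
    define d where "d j = (if j = i then - (\<Sum>j\<in>J'. M k j * c j) else M k i * c j)" for j
    have sum_d: "(\<Sum>j\<in>J. M l j * d j) =
        (\<Sum>j\<in>J'. (M k i * M l j - M l i * M k j) * c j)" for l
    proof -
      have "(\<Sum>j\<in>J'. M l j * d j) = (\<Sum>j\<in>J'. M l j * (M k i * c j))"
        using J'(3) by (intro sum.cong) (auto simp: d_def)
      then show ?thesis
        using J' by (simp add: d_def algebra_simps sum_subtractf sum_distrib_left)
    qed
    have "(\<Sum>j\<in>J. M l j * d j) = 0" if "l \<in> insert k K" for l
      using that c(2) by (auto simp: sum_d)
    moreover have "\<exists>j\<in>J. d j \<noteq> 0"
      using c(1) i J'(3) by (auto simp: d_def J'(2))
    ultimately show ?thesis by blast
  qed
qed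

section \<open>Matrices preserving commutation\<close>

definition neighbours :: "'a set set \<Rightarrow> 'a \<Rightarrow> 'a set" where
  "neighbours E v = {w. {v, w} \<in> E}"

abbreviation degree :: "'a set set \<Rightarrow> 'a \<Rightarrow> nat" where
  "degree E v \<equiv> card (neighbours E v)"

lemma simple_graphD:
  assumes "simple_graph V E"
  shows "finite V" "neighbours E v \<subseteq> V" "v \<notin> neighbours E v" "finite (neighbours E v)"
proof -
  show "finite V" using assms by (simp add: simple_graph_def)
  moreover show "neighbours E v \<subseteq> V" "v \<notin> neighbours E v"
    using assms by (fastforce simp: simple_graph_def neighbours_def doubleton_eq_iff)+
  ultimately show "finite (neighbours E v)" using finite_subset by blast
qed

lemma simple_graph_edgeD:
  assumes "simple_graph V E" "{v, w} \<in> E"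
  shows "v \<in> V \<and> w \<in> V \<and> v \<noteq> w"
  using assms(2) simple_graphD(2,3)[OF assms(1), of v] simple_graphD(2)[OF assms(1), of w]
  by (auto simp: neighbours_def insert_commute)

text \<open>The inclusions say that \<open>u\<close> and \<open>v\<close> have the same neighbours
  apart from each other, so swapping them would be an automorphism.\<close>

lemma transposition_free_twins:
  assumes g: "simple_graph V E" "transposition_free V E" and uv: "u \<in> V" "v \<in> V"
    and sub: "neighbours E u - {v} \<subseteq> neighbours E v" "neighbours E v - {u} \<subseteq> neighbours E u"
  shows "u = v"
proof (rule ccontr)
  assume "u \<noteq> v"
  have *: "{u, x} \<in> E \<longleftrightarrow> {v, x} \<in> E" if "x \<noteq> u" "x \<noteq> v" for x
    using sub that by (auto simp: neighbours_def)
  have irr: "{x, x} \<notin> E" for x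
    using simple_graphD(3)[OF g(1), of x] by (simp add: neighbours_def)
  have "graph_automorphism V E (transpose u v)"
    unfolding graph_automorphism_def
  proof (intro conjI ballI)
    show "bij_betw (transpose u v) V V"
      using uv by (simp add: bij_betw_def transpose_image_eq)
    fix x y
    show "{x, y} \<in> E \<longleftrightarrow> {transpose u v x, transpose u v y} \<in> E"
      using *[of x] *[of y] irr \<open>u \<noteq> v\<close> doubleton_eq_iff[of x y]
      unfolding transpose_def by (cases "x = u"; cases "x = v"; cases "y = u"; cases "y = v")
        (simp_all add: insert_commute[of x] insert_commute[of v u])
  qed
  with g(2) uv \<open>u \<noteq> v\<close> show False by (auto simp: transposition_free_def)
qed

definition inverse_matrices :: "'a set \<Rightarrow> ('a \<Rightarrow> 'a \<Rightarrow> int) \<Rightarrow> ('a \<Rightarrow> 'a \<Rightarrow> int) \<Rightarrow> bool" where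
  "inverse_matrices V A B \<longleftrightarrow>
    (\<forall>u\<in>V. \<forall>v\<in>V. (\<Sum>w\<in>V. A u w * B w v) = of_bool (u = v) \<and>
                  (\<Sum>w\<in>V. B u w * A w v) = of_bool (u = v))"

text \<open>Column \<open>v\<close> is meant as the image of the generator \<open>v\<close> in the
  abelianization. The condition expresses that images of commuting generators commute modulo the
  third term of the series: their 2-by-2 minors vanish on the edges.\<close>

definition graph_matrix :: "'a set \<Rightarrow> 'a set set \<Rightarrow> ('a \<Rightarrow> 'a \<Rightarrow> int) \<Rightarrow> bool" where
  "graph_matrix V E A \<longleftrightarrow>
    (\<forall>v\<in>V. \<forall>w\<in>V. \<forall>x y. {v, w} \<notin> E \<longrightarrow> {x, y} \<in> E \<longrightarrow> A x v * A y w = A y v * A x w)"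

lemma inverse_matrices_sym: "inverse_matrices V A B \<Longrightarrow> inverse_matrices V B A"
  by (auto simp: inverse_matrices_def)

text \<open>Applying \<open>B\<close> recovers the coefficients, so the columns of \<open>A\<close>
  are linearly independent.\<close>

lemma inverse_matrices_kernel:
  assumes "inverse_matrices V A B" "finite V" "J \<subseteq> V"
    and 0: "\<And>y. y \<in> V \<Longrightarrow> (\<Sum>j\<in>J. A y j * c j) = 0" and "i \<in> J"
  shows "c i = 0"
proof -
  have "0 = (\<Sum>y\<in>V. B i y * (\<Sum>j\<in>J. A y j * c j))"
    using 0 by simp
  also have "\<dots> = (\<Sum>j\<in>J. (\<Sum>y\<in>V. B i y * A y j) * c j)"
    by (subst sum_distrib_left, subst sum.swap) (simp add: sum_distrib_right mult.assoc)
  also have "\<dots> = (\<Sum>j\<in>J. of_bool (i = j) * c j)"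
    using assms by (intro sum.cong) (auto simp: inverse_matrices_def subset_eq)
  also have "\<dots> = c i"
    using assms(2,3,5) by (simp add: of_bool_def if_distrib[of "\<lambda>x. x * _"] finite_subset cong: if_cong)
  finally show ?thesis by simp
qed

text \<open>
  The column \<open>w\<close> of \<open>A\<close> commutes with the column \<open>v\<close> for each \<open>w\<close> not adjacent to \<open>v\<close>, which
  determines its entries at the neighbours of \<open>u\<close> from the other ones.
\<close>

lemma graph_matrix_column:
  assumes "graph_matrix V E A" "v \<in> V" "w \<in> V - neighbours E v" "y \<in> neighbours E u"
  shows "A u v * A y w = A y v * A u w"
  using assms by (auto simp: graph_matrix_def neighbours_def)

context
  fixes V :: "'a set" and E :: "'a set set" and A B :: "'a \<Rightarrow> 'a \<Rightarrow> int"
  assumes graph: "simple_graph V E"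
    and inverse: "inverse_matrices V A B" and matrix: "graph_matrix V E A"
begin

text \<open>If \<open>u\<close> had larger degree, the columns of the vertices not adjacent to
  \<open>v\<close> would outnumber the rows outside the neighbourhood of \<open>u\<close>, so a
  nontrivial combination of them would vanish on those rows. Its entry at \<open>u\<close> is then
  zero, and by \<open>graph_matrix_column\<close> so are those at the neighbours of
  \<open>u\<close>, against the independence of the columns.\<close>

lemma graph_matrix_degree_le:
  assumes "u \<in> V" "v \<in> V" "A u v \<noteq> 0"
  shows "degree E u \<le> degree E v"
proof (rule ccontr)
  note fin = simple_graphD[OF graph]
  assume "\<not> ?thesis"
  moreover have "degree E u \<le> card V" by (simp add: card_mono fin)
  ultimately have "card (V - neighbours E u) < card (V - neighbours E v)"
    using fin by (simp add: card_Diff_subset)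
  from homogeneous_system_nontrivial[OF _ _ this, where M = A]
  obtain c where c: "\<exists>j\<in>V - neighbours E v. c j \<noteq> 0"
    "\<forall>y\<in>V - neighbours E u. (\<Sum>j\<in>V - neighbours E v. A y j * c j) = 0"
    using fin(1) by blast
  have "(\<Sum>j\<in>V - neighbours E v. A y j * c j) = 0" if "y \<in> V" for y
  proof (cases "y \<in> neighbours E u")
    case True
    have "A u v * (\<Sum>j\<in>V - neighbours E v. A y j * c j) =
        A y v * (\<Sum>j\<in>V - neighbours E v. A u j * c j)"
      unfolding sum_distrib_left
      using graph_matrix_column[OF matrix assms(2) _ True]
      by (intro sum.cong) (auto simp: mult.assoc[symmetric])
    then show ?thesis
      using c(2)[rule_format, of u] assms fin by auto
  qed (use c that in auto)
  with c(1) show False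
    using inverse_matrices_kernel[OF inverse fin(1), of "V - neighbours E v" c] by auto
qed

text \<open>At equal degrees the count of \<open>graph_matrix_degree_le\<close> still succeeds once
  the unit vector at a bad vertex \<open>z\<close> joins the columns. The resulting relation
  expresses a nonzero multiple of this unit vector by columns commuting with column
  \<open>v\<close>, which the entries at \<open>u'\<close> and \<open>z\<close> forbid.\<close>

lemma graph_matrix_neighbours:
  assumes "u \<in> V" "v \<in> V" "u' \<in> V" "A u v \<noteq> 0" "A u' v \<noteq> 0" "degree E u = degree E v"
  shows "neighbours E u' - {u} \<subseteq> neighbours E u"
proof (intro subsetI, rule ccontr)
  note fin = simple_graphD[OF graph]
  fix z assume z: "z \<in> neighbours E u' - {u}" "z \<notin> neighbours E u"
  define J where "J = V - neighbours E v"
  \<comment> \<open>\<open>None\<close> is the index of the unit vector at \<open>z\<close>.\<close>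
  define M where "M y j = (case j of None \<Rightarrow> of_bool (y = z) | Some w \<Rightarrow> A y w)" for y j
  have J: "finite J" "J \<subseteq> V" using fin by (auto simp: J_def)
  have sumM: "(\<Sum>j\<in>insert None (Some ` J). M y j * c j) =
      of_bool (y = z) * c None + (\<Sum>w\<in>J. A y w * c (Some w))" for y c
    using J by (simp add: M_def sum.reindex)
  have "card (V - neighbours E u) = card J"
    using fin assms by (simp add: card_Diff_subset J_def)
  then have "card (V - neighbours E u) < card (insert None (Some ` J))"
    using J by (simp add: card_image)
  from homogeneous_system_nontrivial[OF _ _ this, where M = M]
  obtain c where c: "\<exists>j\<in>insert None (Some ` J). c j \<noteq> 0"
    "\<forall>y\<in>V - neighbours E u. of_bool (y = z) * c None + (\<Sum>w\<in>J. A y w * c (Some w)) = 0"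
    unfolding sumM using fin(1) J(1) by blast
  have col: "A x v * (\<Sum>w\<in>J. A y w * c (Some w)) = A y v * (\<Sum>w\<in>J. A x w * c (Some w))"
    if "y \<in> neighbours E x" for x y
    unfolding sum_distrib_left
    using graph_matrix_column[OF matrix assms(2) _ that]
    by (intro sum.cong) (auto simp: mult.assoc[symmetric] J_def)
  have all: "of_bool (y = z) * c None + (\<Sum>w\<in>J. A y w * c (Some w)) = 0" if "y \<in> V" for y
  proof (cases "y \<in> neighbours E u")
    case True
    then show ?thesis
      using c(2)[rule_format, of u] assms(1,4) fin z col[OF True] by auto
  qed (use c that in auto)
  have "c None \<noteq> 0"
  proof
    assume None: "c None = 0"
    then have "c (Some w) = 0" if "w \<in> J" for w
      using inverse_matrices_kernel[OF inverse fin(1) J(2) _ that, of "\<lambda>w. c (Some w)"] all by simp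
    with None c(1) show False by auto
  qed
  moreover have "z \<in> V" "z \<noteq> u'" using z fin by auto
  \<comment> \<open>The combination of columns vanishes at \<open>u'\<close>, hence at its neighbour
    \<open>z\<close>, where the relation needs a nonzero value.\<close>
  ultimately show False
    using all[of u'] all[of z] col[of z u'] assms(3,5) z by auto
qed

text \<open>\<open>graph_matrix_neighbours\<close> applies in both directions and makes
  \<open>u\<close> and \<open>u'\<close> twins.\<close>

lemma graph_matrix_unique:
  assumes "transposition_free V E" "u \<in> V" "v \<in> V" "u' \<in> V" "A u v \<noteq> 0" "A u' v \<noteq> 0"
    and "degree E u = degree E v" "degree E u' = degree E v"
  shows "u = u'"
  using assms graph_matrix_neighbours
  by (intro transposition_free_twins[OF graph assms(1)]) auto

end

section \<open>The leading permutation of an automorphism matrix\<close>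

text \<open>The diagonal entry \<open>1\<close> of the product of \<open>B\<close> and
  \<open>A\<close> yields \<open>u\<close> with \<open>B v u * A u v\<close> nonzero, and the degree
  bounds for \<open>A\<close> and \<open>B\<close> force equal degrees. Any other nonzero term would
  need a vertex of smaller degree than \<open>v\<close> by \<open>A\<close> but not by
  \<open>B\<close>, so this one product is \<open>1\<close> and its factors are units.\<close>

lemma graph_matrix_monomial:
  assumes graph: "simple_graph V E" "transposition_free V E"
    and inverse: "inverse_matrices V A B" and matrix: "graph_matrix V E A" "graph_matrix V E B"
    and v: "v \<in> V"
  obtains u where "u \<in> V" "degree E u = degree E v" "\<bar>A u v\<bar> = 1" "B v u \<noteq> 0"
    and "\<And>x. x \<in> V \<Longrightarrow> A x v \<noteq> 0 \<Longrightarrow> x = u \<or> degree E x < degree E v"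
proof -
  note fin = simple_graphD[OF graph(1)]
  note A = graph_matrix_degree_le[OF graph(1) inverse matrix(1)]
    graph_matrix_unique[OF graph(1) inverse matrix(1) graph(2)]
  note B = graph_matrix_degree_le[OF graph(1) inverse_matrices_sym[OF inverse] matrix(2)]
  have sum: "(\<Sum>w\<in>V. B v w * A w v) = 1"
    using inverse v by (simp add: inverse_matrices_def)
  then have "\<not> (\<forall>u\<in>V. B v u * A u v = 0)"
    using sum.neutral[of V "\<lambda>u. B v u * A u v"] by fastforce
  then obtain u where u: "u \<in> V" "B v u \<noteq> 0" "A u v \<noteq> 0"
    by auto
  then have deg: "degree E u = degree E v"
    using A(1)[OF u(1) v u(3)] B[OF v u(1,2)] by simp
  have uniq: "x = u \<or> degree E x < degree E v" if "x \<in> V" "A x v \<noteq> 0" for x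
    using A(1)[OF that(1) v that(2)] A(2)[OF that(1) v u(1) that(2) u(3)] deg by auto
  have "B v w * A w v = 0" if "w \<in> V - {u}" for w
    using uniq[of w] B[OF v, of w] that by force
  then have "(\<Sum>w\<in>V - {u}. B v w * A w v) = 0"
    by (intro sum.neutral) auto
  then have "B v u * A u v = 1"
    using sum sum.remove[OF fin(1) u(1), of "\<lambda>w. B v w * A w v"] by linarith
  then have "\<bar>A u v\<bar> = 1"
    using abs_zmult_eq_1[of "A u v" "B v u"] unfolding mult.commute[of "A u v"] by linarith
  then show thesis
    by (rule that[OF u(1) deg _ u(2) uniq])
qed

text \<open>The leading vertices of the columns of \<open>B\<close> give a left inverse of
  \<open>\<theta>\<close>: since \<open>B v (\<theta> v)\<close> is nonzero at equal degrees,
  \<open>v\<close> leads column \<open>\<theta> v\<close> of \<open>B\<close>.\<close>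

lemma graph_matrix_permutation:
  assumes graph: "simple_graph V E" "transposition_free V E"
    and inverse: "inverse_matrices V A B" and matrix: "graph_matrix V E A" "graph_matrix V E B"
  obtains \<theta> where "\<theta> permutes V"
    and "\<And>v. v \<in> V \<Longrightarrow> degree E (\<theta> v) = degree E v"
    and "\<And>v. v \<in> V \<Longrightarrow> \<bar>A (\<theta> v) v\<bar> = 1"
    and "\<And>x v. x \<in> V \<Longrightarrow> v \<in> V \<Longrightarrow> A x v \<noteq> 0 \<Longrightarrow> x = \<theta> v \<or> degree E x < degree E v"
    and "\<And>v w. {\<theta> v, \<theta> w} \<in> E \<longleftrightarrow> {v, w} \<in> E"
proof -
  note fin = simple_graphD[OF graph(1)]
  \<comment> \<open>The pair is generic, so that the statement also covers the inverse
    matrix.\<close>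
  have ex: "\<exists>\<theta>. (\<forall>v\<in>V. \<theta> v \<in> V \<and> degree E (\<theta> v) = degree E v \<and> \<bar>A (\<theta> v) v\<bar> = 1 \<and> B v (\<theta> v) \<noteq> 0 \<and>
      (\<forall>x\<in>V. A x v \<noteq> 0 \<longrightarrow> x = \<theta> v \<or> degree E x < degree E v)) \<and> (\<forall>v. v \<notin> V \<longrightarrow> \<theta> v = v)"
    if "inverse_matrices V A B" "graph_matrix V E A" "graph_matrix V E B" for A B
  proof -
    have "\<forall>v\<in>V. \<exists>u. u \<in> V \<and> degree E u = degree E v \<and> \<bar>A u v\<bar> = 1 \<and> B v u \<noteq> 0 \<and>
      (\<forall>x\<in>V. A x v \<noteq> 0 \<longrightarrow> x = u \<or> degree E x < degree E v)"
      using graph_matrix_monomial[OF graph that] by metis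
    then obtain \<theta> where \<theta>: "\<forall>v\<in>V. \<theta> v \<in> V \<and> degree E (\<theta> v) = degree E v \<and> \<bar>A (\<theta> v) v\<bar> = 1 \<and>
      B v (\<theta> v) \<noteq> 0 \<and> (\<forall>x\<in>V. A x v \<noteq> 0 \<longrightarrow> x = \<theta> v \<or> degree E x < degree E v)"
      by metis
    show ?thesis
      by (rule exI[of _ "\<lambda>v. if v \<in> V then \<theta> v else v"]) (use \<theta> in simp)
  qed
  \<comment> \<open>Were the images adjacent, the vanishing minor would make both crossed entries
    nonzero, and each of \<open>v\<close> and \<open>w\<close> would have smaller degree than the
    other.\<close>
  have nonadjacent: "{\<theta> v, \<theta> w} \<notin> E"
    if "graph_matrix V E A" and vw: "v \<in> V" "w \<in> V" "{v, w} \<notin> E"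
      and \<theta>: "\<forall>v\<in>V. \<theta> v \<in> V \<and> degree E (\<theta> v) = degree E v \<and> \<bar>A (\<theta> v) v\<bar> = 1 \<and>
        (\<forall>x\<in>V. A x v \<noteq> 0 \<longrightarrow> x = \<theta> v \<or> degree E x < degree E v)"
    for A \<theta> v w
  proof
    assume adj: "{\<theta> v, \<theta> w} \<in> E"
    then have "\<theta> w \<noteq> \<theta> v"
      using fin(3)[of "\<theta> v"] by (auto simp: neighbours_def)
    moreover have "A (\<theta> v) v \<noteq> 0" "A (\<theta> w) w \<noteq> 0"
      using \<theta> vw by force+
    then have "A (\<theta> w) v \<noteq> 0" "A (\<theta> v) w \<noteq> 0"
      using that(1) vw adj unfolding graph_matrix_def by (metis mult_eq_0_iff)+
    ultimately have "degree E (\<theta> w) < degree E v" "degree E (\<theta> v) < degree E w"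
      using \<theta> vw by metis+
    then show False using \<theta> vw by simp
  qed
  from ex[OF inverse matrix] obtain \<theta> where \<theta>: "\<forall>v\<in>V. \<theta> v \<in> V \<and> degree E (\<theta> v) = degree E v \<and>
      \<bar>A (\<theta> v) v\<bar> = 1 \<and> B v (\<theta> v) \<noteq> 0 \<and>
      (\<forall>x\<in>V. A x v \<noteq> 0 \<longrightarrow> x = \<theta> v \<or> degree E x < degree E v)" "\<forall>v. v \<notin> V \<longrightarrow> \<theta> v = v"
    by blast
  from ex[OF inverse_matrices_sym[OF inverse] matrix(2,1)]
  obtain \<eta> where \<eta>: "\<forall>v\<in>V. \<eta> v \<in> V \<and> degree E (\<eta> v) = degree E v \<and>
      \<bar>B (\<eta> v) v\<bar> = 1 \<and> A v (\<eta> v) \<noteq> 0 \<and>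
      (\<forall>x\<in>V. B x v \<noteq> 0 \<longrightarrow> x = \<eta> v \<or> degree E x < degree E v)" "\<forall>v. v \<notin> V \<longrightarrow> \<eta> v = v"
    by blast
  have \<eta>\<theta>: "\<eta> (\<theta> v) = v" for v
  proof (cases "v \<in> V")
    case True
    with \<theta>(1) have "B v (\<theta> v) \<noteq> 0" "\<theta> v \<in> V" "degree E (\<theta> v) = degree E v" by auto
    with True \<eta>(1) show ?thesis by force
  qed (use \<theta> \<eta> in simp)
  show thesis
  proof
    show "\<theta> permutes V"
      using \<theta> \<eta>\<theta> fin(1) by (intro inj_imp_permutes) (auto intro: inj_on_inverseI[of _ \<eta>])
    show "{\<theta> v, \<theta> w} \<in> E \<longleftrightarrow> {v, w} \<in> E" for v w
    proof (cases "v \<in> V \<and> w \<in> V")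
      case True
      have "{\<theta> v, \<theta> w} \<notin> E" if "{v, w} \<notin> E"
        by (rule nonadjacent[OF matrix(1) _ _ that, of \<theta>]) (use True \<theta>(1) in blast)+
      \<comment> \<open>The same fact for the inverse matrix gives the other direction.\<close>
      moreover have "{\<eta> (\<theta> v), \<eta> (\<theta> w)} \<notin> E" if "{\<theta> v, \<theta> w} \<notin> E"
        by (rule nonadjacent[OF matrix(2) _ _ that, of \<eta>]) (use True \<theta>(1) \<eta>(1) in blast)+
      ultimately show ?thesis by (auto simp: \<eta>\<theta>)
    next
      case False
      have outside: "{x, y} \<notin> E" if "x \<notin> V \<or> y \<notin> V" for x y
        using that fin(2)[of x] fin(2)[of y] by (auto simp: neighbours_def insert_commute)
      have "\<theta> v \<notin> V \<or> \<theta> w \<notin> V" using False \<theta>(2) by auto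
      then show ?thesis using False by (simp add: outside)
    qed
  qed (use \<theta> in auto)
qed

section \<open>Triangular maps over signed permutations\<close>

definition orbit_sign :: "('a \<Rightarrow> int) \<Rightarrow> ('a \<Rightarrow> 'a) \<Rightarrow> nat \<Rightarrow> 'a \<Rightarrow> int" where
  "orbit_sign s \<theta> k i = (\<Prod>j<k. s ((\<theta> ^^ j) i))"

text \<open>
  The unknowns are the values of \<open>\<mu>\<close> at indices of weight at least that of \<open>i\<^sub>0\<close>. There are as many
  equations, but the one at \<open>i\<^sub>0\<close> follows from those at the other points of its orbit.
\<close>

lemma invariant_functional:
  fixes M :: "'i \<Rightarrow> 'i \<Rightarrow> int" and wt :: "'i \<Rightarrow> nat"
  assumes fin: "finite I" and perm: "\<theta> permutes I"
    and wt: "\<And>i. i \<in> I \<Longrightarrow> wt (\<theta> i) = wt i"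
    and M_\<theta>: "\<And>i. i \<in> I \<Longrightarrow> M (\<theta> i) i = s i"
    and M: "\<And>i j. i \<in> I \<Longrightarrow> j \<in> I \<Longrightarrow> M j i \<noteq> 0 \<Longrightarrow> j = \<theta> i \<or> wt j < wt i"
    and i0: "i\<^sub>0 \<in> I" and sign: "\<And>k. (\<theta> ^^ k) i\<^sub>0 = i\<^sub>0 \<Longrightarrow> orbit_sign s \<theta> k i\<^sub>0 = 1"
  shows "\<exists>\<mu>. (\<exists>i\<in>I. \<mu> i \<noteq> 0) \<and> (\<forall>i\<in>I. (\<Sum>j\<in>I. \<mu> j * M j i) = \<mu> i)"
proof -
  define d where "d = wt i\<^sub>0"
  define K where "K = {i\<in>I. d \<le> wt i}"
  have K: "finite K" "i\<^sub>0 \<in> K" using fin i0 by (auto simp: K_def d_def)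
  then have "card (K - {i\<^sub>0}) < card K" by (rule card_Diff1_less)
  \<comment> \<open>The coefficients are those of the identity minus the transpose of
    \<open>M\<close>, with the equation at \<open>i\<^sub>0\<close> left out.\<close>
  from homogeneous_system_nontrivial[OF _ _ this, where M = "\<lambda>i j. of_bool (j = i) - M j i"]
  obtain c where c: "\<exists>j\<in>K. c j \<noteq> 0"
    "\<forall>i\<in>K - {i\<^sub>0}. (\<Sum>j\<in>K. (of_bool (j = i) - M j i) * c j) = 0"
    using K(1) by blast
  have eq: "(\<Sum>j\<in>K. c j * M j i) = c i" if "i \<in> K - {i\<^sub>0}" for i
  proof -
    have "(\<Sum>j\<in>K. (of_bool (j = i) - M j i) * c j) = (\<Sum>j\<in>K. of_bool (j = i) * c j) - (\<Sum>j\<in>K. c j * M j i)"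
      by (simp add: algebra_simps sum_subtractf)
    moreover have "(\<Sum>j\<in>K. of_bool (j = i) * c j) = (\<Sum>j\<in>K. if j = i then c j else 0)"
      by (intro sum.cong) auto
    ultimately show ?thesis using c(2)[rule_format, OF that] that K(1) by simp
  qed
  have orbit: "(\<theta> ^^ k) i\<^sub>0 \<in> I" "wt ((\<theta> ^^ k) i\<^sub>0) = d" for k
    by (induction k) (auto simp: i0 d_def wt permutes_in_image[OF perm])
  \<comment> \<open>At weight \<open>d\<close> the other nonzero entries sit at smaller weights,
    outside \<open>K\<close>.\<close>
  have row: "(\<Sum>j\<in>K. c j * M j i) = s i * c (\<theta> i)" if "i \<in> I" "wt i = d" for i
  proof -
    have "\<theta> i \<in> K" using that wt permutes_in_image[OF perm] by (simp add: K_def)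
    moreover have "c j * M j i = 0" if "j \<in> K - {\<theta> i}" for j
      using M[OF \<open>i \<in> I\<close>, of j] that \<open>wt i = d\<close> by (auto simp: K_def)
    then have "(\<Sum>j\<in>K - {\<theta> i}. c j * M j i) = 0"
      by (intro sum.neutral) blast
    ultimately have "(\<Sum>j\<in>K. c j * M j i) = c (\<theta> i) * M (\<theta> i) i"
      using sum.remove[OF K(1), of "\<theta> i" "\<lambda>j. c j * M j i"] by linarith
    then show ?thesis using M_\<theta>[OF that(1)] by simp
  qed
  define m where "m = least_power \<theta> i\<^sub>0"
  have "permutation \<theta>"
    using perm fin permutation_permutes by blast
  then have m: "(\<theta> ^^ m) i\<^sub>0 = i\<^sub>0" "m > 0"
    using least_power_of_permutation[of \<theta> i\<^sub>0] by (simp_all add: m_def)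
  \<comment> \<open>The chain starts at \<open>\<theta> i\<^sub>0\<close> and uses the equations at
    the other points of the orbit only. At length \<open>m\<close> it closes up and yields the
    equation at \<open>i\<^sub>0\<close>.\<close>
  have "Suc k \<le> m \<Longrightarrow> s i\<^sub>0 * c (\<theta> i\<^sub>0) = orbit_sign s \<theta> (Suc k) i\<^sub>0 * c ((\<theta> ^^ Suc k) i\<^sub>0)" for k
  proof (induction k)
    case (Suc k)
    have "(\<theta> ^^ Suc k) i\<^sub>0 \<noteq> i\<^sub>0"
      using Suc.prems least_power_le[of "Suc k" \<theta> i\<^sub>0] by (auto simp: m_def)
    then have "c ((\<theta> ^^ Suc k) i\<^sub>0) = s ((\<theta> ^^ Suc k) i\<^sub>0) * c ((\<theta> ^^ Suc (Suc k)) i\<^sub>0)"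
      using eq[of "(\<theta> ^^ Suc k) i\<^sub>0"] row[of "(\<theta> ^^ Suc k) i\<^sub>0"] orbit[of "Suc k"] by (simp add: K_def)
    with Suc show ?case by (simp add: orbit_sign_def)
  qed (simp add: orbit_sign_def)
  from this[of "m - 1"] have "s i\<^sub>0 * c (\<theta> i\<^sub>0) = c i\<^sub>0"
    using m sign[OF m(1)] by simp
  then have eq: "(\<Sum>j\<in>K. c j * M j i) = c i" if "i \<in> K" for i
    using eq[of i] row[OF i0] that by (cases "i = i\<^sub>0") (auto simp: d_def)
  define \<mu> where "\<mu> j = (if j \<in> K then c j else 0)" for j
  have "(\<Sum>j\<in>I. \<mu> j * M j i) = \<mu> i" if "i \<in> I" for i
  proof -
    have "(\<Sum>j\<in>I. \<mu> j * M j i) = (\<Sum>j\<in>K. c j * M j i)"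
      by (rule sum.mono_neutral_cong_right) (use fin in \<open>auto simp: K_def \<mu>_def\<close>)
    also have "\<dots> = \<mu> i"
    proof (cases "i \<in> K")
      case False
      with that have "wt i < d" by (simp add: K_def)
      then have "M j i = 0" if "j \<in> K" for j
        using M[OF \<open>i \<in> I\<close>, of j] wt[OF \<open>i \<in> I\<close>] that by (cases "M j i = 0") (auto simp: K_def)
      with False show ?thesis by (simp add: \<mu>_def)
    qed (simp add: eq \<mu>_def)
    finally show ?thesis .
  qed
  moreover have "\<exists>i\<in>I. \<mu> i \<noteq> 0" using c(1) by (auto simp: \<mu>_def K_def)
  ultimately show ?thesis by blast
qed

section \<open>Orbit signs and 2-adic valuations of orbit lengths\<close>

lemma orbit_sign_add:
  "orbit_sign s \<theta> (m + k) i = orbit_sign s \<theta> m i * orbit_sign s \<theta> k ((\<theta> ^^ m) i)"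
proof (induction k)
  case (Suc k)
  have "(\<theta> ^^ (m + k)) i = (\<theta> ^^ k) ((\<theta> ^^ m) i)"
    by (metis add.commute comp_apply funpow_add)
  with Suc show ?case by (simp add: orbit_sign_def)
qed (simp add: orbit_sign_def)

lemma orbit_sign_power:
  "(\<theta> ^^ p) i = i \<Longrightarrow> orbit_sign s \<theta> (p * q) i = orbit_sign s \<theta> p i ^ q"
  by (induction q) (simp_all add: orbit_sign_add, simp add: orbit_sign_def)

text \<open>Powers of \<open>\<theta>\<close> commute and are injective, so the same powers fix both
  points.\<close>

lemma least_power_orbit:
  assumes "permutation \<theta>"
  shows "least_power \<theta> ((\<theta> ^^ m) v) = least_power \<theta> v"
proof -
  have "(\<theta> ^^ n) ((\<theta> ^^ m) v) = (\<theta> ^^ m) v \<longleftrightarrow> (\<theta> ^^ n) v = v" for n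
  proof -
    have "(\<theta> ^^ n) ((\<theta> ^^ m) v) = (\<theta> ^^ m) ((\<theta> ^^ n) v)"
      by (metis add.commute comp_apply funpow_add)
    moreover have "inj (\<theta> ^^ m)"
      using assms by (simp add: inj_fn permutation_bijective bij_is_inj)
    ultimately show ?thesis by (metis injD)
  qed
  then show ?thesis
    using least_power_dvd[OF assms] by (metis dvd_antisym dvd_refl)
qed

lemma two_power_times_odd:
  fixes n :: nat
  assumes "n > 0"
  obtains a where "n = 2 ^ multiplicity 2 n * a" "odd a"
  by (rule multiplicity_decompose'[of n 2]) (use assms in auto)

context
  fixes V :: "'a set" and \<theta> :: "'a \<Rightarrow> 'a" and s :: "'a \<Rightarrow> int"
  assumes fin: "finite V" and perm: "\<theta> permutes V"
    and sign: "\<And>v. v \<in> V \<Longrightarrow> \<bar>s v\<bar> = 1"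
    and negative: "\<And>v. v \<in> V \<Longrightarrow> \<exists>k. (\<theta> ^^ k) v = v \<and> orbit_sign s \<theta> k v \<noteq> 1"
begin

lemma finite_permutes_permutation: "permutation \<theta>"
  using perm fin permutation_permutes by blast

lemma permutes_funpow_in: "v \<in> V \<Longrightarrow> (\<theta> ^^ k) v \<in> V"
  by (induction k) (auto simp: permutes_in_image[OF perm])

lemma orbit_sign_abs: "v \<in> V \<Longrightarrow> \<bar>orbit_sign s \<theta> k v\<bar> = 1"
  by (induction k) (simp_all add: orbit_sign_def abs_mult sign permutes_funpow_in)

text \<open>A return with sign different from \<open>1\<close> takes a multiple of the period, and
  its sign is a power of the sign of one period, which must therefore be \<open>-1\<close>.\<close>

lemma orbit_sign_period:
  assumes "v \<in> V"
  shows "orbit_sign s \<theta> (least_power \<theta> v * q) v = (-1) ^ q"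
proof -
  let ?p = "least_power \<theta> v"
  have p: "(\<theta> ^^ ?p) v = v"
    by (rule least_power_of_permutation[OF finite_permutes_permutation])
  obtain k where k: "(\<theta> ^^ k) v = v" "orbit_sign s \<theta> k v \<noteq> 1"
    using negative assms by blast
  from k(1) obtain r where "k = ?p * r"
    using least_power_dvd[OF finite_permutes_permutation] by blast
  with k(2) have "orbit_sign s \<theta> ?p v \<noteq> 1"
    by (auto simp: orbit_sign_power[OF p])
  then have "orbit_sign s \<theta> ?p v = -1"
    using orbit_sign_abs[OF assms, of ?p] by linarith
  then show ?thesis by (simp add: orbit_sign_power[OF p])
qed

text \<open>The return time \<open>k + k\<close> is an odd multiple of the period, since
  \<open>k\<close> steps do not bring \<open>v\<close> back.\<close>

lemma orbit_sign_swap: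
  assumes "v \<in> V" "w \<noteq> v" "(\<theta> ^^ k) v = w" "(\<theta> ^^ k) w = v"
  shows "orbit_sign s \<theta> k v * orbit_sign s \<theta> k w = -1"
proof -
  let ?p = "least_power \<theta> v"
  have "(\<theta> ^^ (k + k)) v = v" using assms by (simp add: funpow_add)
  then obtain q where q: "k + k = ?p * q"
    using least_power_dvd[OF finite_permutes_permutation] by blast
  have "odd q"
  proof
    assume "even q"
    then obtain t where "q = 2 * t" by (elim evenE)
    with q have "k = ?p * t" by (simp add: algebra_simps)
    then have "?p dvd k" by simp
    then show False using assms least_power_dvd[OF finite_permutes_permutation] by blast
  qed
  then show ?thesis
    using orbit_sign_period[OF assms(1), of q] orbit_sign_add[of s \<theta> k k v] assms(3) q by simp
qed

text \<open>Here \<open>k\<close> is \<open>q\<close> periods of \<open>v\<close> and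
  \<open>t\<close> periods of \<open>w\<close>; equal valuations of the periods give
  \<open>q\<close> and \<open>t\<close> the same parity.\<close>

lemma orbit_sign_fixed:
  assumes "v \<in> V" "w \<in> V" "(\<theta> ^^ k) v = v" "(\<theta> ^^ k) w = w"
    and "multiplicity 2 (least_power \<theta> v) = multiplicity 2 (least_power \<theta> w)"
  shows "orbit_sign s \<theta> k v * orbit_sign s \<theta> k w = 1"
proof -
  let ?p = "least_power \<theta> v" and ?r = "least_power \<theta> w"
  obtain q where q: "k = ?p * q" using least_power_dvd[OF finite_permutes_permutation] assms(3) by blast
  obtain t where t: "k = ?r * t" using least_power_dvd[OF finite_permutes_permutation] assms(4) by blast
  note pos = least_power_of_permutation(2)[OF finite_permutes_permutation]
  obtain a where a: "?p = 2 ^ multiplicity 2 ?p * a" "odd a"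
    by (rule two_power_times_odd[OF pos])
  obtain b where b: "?r = 2 ^ multiplicity 2 ?r * b" "odd b"
    by (rule two_power_times_odd[OF pos])
  have "2 ^ multiplicity 2 ?p * (a * q) = 2 ^ multiplicity 2 ?p * (b * t)"
    using q t a(1) b(1) assms(5) by (metis mult.assoc)
  then have "a * q = b * t" by simp
  then have "even q = even t" using a(2) b(2) by (metis even_mult_iff)
  then have "(-1 :: int) ^ q * (-1) ^ t = 1"
    by (cases "even q") simp_all
  then show ?thesis
    using orbit_sign_period[OF assms(1), of q] orbit_sign_period[OF assms(2), of t] q t by simp
qed

text \<open>
  Some power of \<open>\<theta>\<close> fixes \<open>u\<close> and moves \<open>v\<close> halfway along its orbit.
\<close>

lemma half_period_adjacent:
  assumes aut: "\<And>v w. {\<theta> v, \<theta> w} \<in> E \<longleftrightarrow> {v, w} \<in> E" and "{u, v} \<in> E"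
    and less: "multiplicity 2 (least_power \<theta> u) < multiplicity 2 (least_power \<theta> v)"
  shows "{u, (\<theta> ^^ (least_power \<theta> v div 2)) v} \<in> E"
proof -
  let ?p = "least_power \<theta> v" and ?l = "least_power \<theta> u"
  note pos = least_power_of_permutation(2)[OF finite_permutes_permutation]
  obtain a where a: "?p = 2 ^ multiplicity 2 ?p * a" "odd a"
    by (rule two_power_times_odd[OF pos])
  obtain b where b: "?l = 2 ^ multiplicity 2 ?l * b" "odd b"
    by (rule two_power_times_odd[OF pos])
  \<comment> \<open>This \<open>e\<close> turns the multiple \<open>2 ^ e * a\<close> of the period
    of \<open>u\<close> into \<open>b\<close> times half the period of \<open>v\<close>; as
    \<open>b\<close> is odd, this is half a period up to full ones.\<close>
  define e where "e = multiplicity 2 ?p - 1 - multiplicity 2 ?l"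
  have e: "multiplicity 2 ?p = Suc (multiplicity 2 ?l + e)" using less by (simp add: e_def)
  from b(2) obtain t where t: "b = 2 * t + 1" by (auto elim: oddE)
  have p: "?p = 2 * (2 ^ (multiplicity 2 ?l + e) * a)"
    using a(1) unfolding e by simp
  then have half: "?p div 2 = 2 ^ (multiplicity 2 ?l + e) * a" by simp
  have "?l * (2 ^ e * a) = 2 ^ multiplicity 2 ?l * b * (2 ^ e * a)"
    using b(1) by simp
  also have "\<dots> = ?p div 2 * b" by (simp add: half power_add)
  also have "\<dots> = ?p div 2 + ?p * t" using p half by (simp add: t algebra_simps)
  finally have k: "?l * (2 ^ e * a) = ?p div 2 + ?p * t" .
  have "(\<theta> ^^ (?p * t)) v = v"
    using least_power_dvd[OF finite_permutes_permutation, of v "?p * t"] by simp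
  then have "(\<theta> ^^ (?l * (2 ^ e * a))) v = (\<theta> ^^ (?p div 2)) v"
    unfolding k by (simp add: funpow_add)
  moreover have "(\<theta> ^^ (?l * (2 ^ e * a))) u = u"
    using least_power_dvd[OF finite_permutes_permutation, of u "?l * (2 ^ e * a)"] by simp
  moreover have "{(\<theta> ^^ k) u, (\<theta> ^^ k) v} \<in> E" for k
    by (induction k) (simp_all add: aut assms(2))
  ultimately show ?thesis by metis
qed

text \<open>A power of \<open>\<theta>\<close> returns an edge to itself by fixing or by exchanging
  its ends; the \<open>-1\<close> in the second case will cancel the sign of reversing an oriented
  edge. It suffices to find an edge whose ends have orbit lengths of equal 2-adic valuation.\<close>

lemma positive_edge:
  assumes graph: "simple_graph V E" "transposition_free V E" "E \<noteq> {}"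
    and aut: "\<And>v w. {\<theta> v, \<theta> w} \<in> E \<longleftrightarrow> {v, w} \<in> E"
  obtains v w where "{v, w} \<in> E"
    "\<And>k. (\<theta> ^^ k) v = v \<Longrightarrow> (\<theta> ^^ k) w = w \<Longrightarrow> orbit_sign s \<theta> k v * orbit_sign s \<theta> k w = 1"
    "\<And>k. (\<theta> ^^ k) v = w \<Longrightarrow> (\<theta> ^^ k) w = v \<Longrightarrow> orbit_sign s \<theta> k v * orbit_sign s \<theta> k w = -1"
proof -
  let ?m = "\<lambda>v. multiplicity 2 (least_power \<theta> v)"
  have inV: "v \<in> V \<and> w \<in> V \<and> w \<noteq> v" if "{v, w} \<in> E" for v w
    using simple_graph_edgeD[OF graph(1) that] by auto
  obtain v\<^sub>1 w\<^sub>1 where e1: "{v\<^sub>1, w\<^sub>1} \<in> E"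
    using graph(1,3) unfolding simple_graph_def by blast
  with inV have "V \<noteq> {}" by blast
  obtain v where v: "v \<in> V" "\<And>u. u \<in> V \<Longrightarrow> ?m u \<le> ?m v"
  proof -
    have "Max (?m ` V) \<in> ?m ` V" using fin \<open>V \<noteq> {}\<close> by (intro Max_in) auto
    then obtain v where "v \<in> V" "?m v = Max (?m ` V)" by force
    then show thesis using fin by (intro that[of v]) auto
  qed
  have "\<exists>v w. {v, w} \<in> E \<and> ?m v = ?m w"
  proof (cases "?m v = 0")
    case True
    \<comment> \<open>If the maximum is zero, all valuations agree and any edge will do.\<close>
    then show ?thesis using e1 inV[OF e1] v(2) by (metis le_zero_eq)
  next
    case False
    then have even: "even (least_power \<theta> v)"
      by (meson not_dvd_imp_multiplicity_0)
    define h where "h = least_power \<theta> v div 2"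
    define w where "w = (\<theta> ^^ h) v"
    have pw: "least_power \<theta> w = least_power \<theta> v"
      unfolding w_def by (rule least_power_orbit[OF finite_permutes_permutation])
    have p0: "least_power \<theta> v > 0" by (rule least_power_of_permutation(2)[OF finite_permutes_permutation])
    have hh: "least_power \<theta> v = h + h" using even by (auto simp: h_def elim: evenE)
    have w: "w \<in> V" "w \<noteq> v"
      using permutes_funpow_in[OF v(1)] least_power_le[of h \<theta> v] p0 hh by (auto simp: w_def)
    have v': "v = (\<theta> ^^ h) w"
      using least_power_of_permutation(1)[OF finite_permutes_permutation, of v] unfolding hh
      by (simp add: w_def funpow_add)
    show ?thesis
    proof (cases "{v, w} \<in> E")
      case True
      then show ?thesis using pw by (intro exI[of _ v] exI[of _ w]) simp
    next
      case False
      \<comment> \<open>Since \<open>v\<close> and \<open>w\<close> are not twins, some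
        \<open>u\<close> is adjacent to exactly one of them. By \<open>half_period_adjacent\<close>
        the valuation at \<open>u\<close> cannot then be below the maximum.\<close>
      have "\<not> (neighbours E v - {w} \<subseteq> neighbours E w \<and> neighbours E w - {v} \<subseteq> neighbours E v)"
        using transposition_free_twins[OF graph(1,2) v(1) w(1)] w(2) by blast
      then obtain u where "{u, v} \<in> E \<and> {u, w} \<notin> E \<or> {u, w} \<in> E \<and> {u, v} \<notin> E"
        by (auto simp: neighbours_def insert_commute)
      then show ?thesis
      proof
        assume u: "{u, v} \<in> E \<and> {u, w} \<notin> E"
        then have "\<not> ?m u < ?m v"
          using half_period_adjacent[OF aut, of u v] by (auto simp flip: w_def h_def)
        then show ?thesis using u inV v(2) by (metis le_neq_implies_less)
      next
        assume u: "{u, w} \<in> E \<and> {u, v} \<notin> E"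
        then have "\<not> ?m u < ?m w"
          using half_period_adjacent[OF aut, of u w] by (auto simp: pw simp flip: v' h_def)
        then show ?thesis using u inV v(2) pw by (metis le_neq_implies_less)
      qed
    qed
  qed
  then obtain v w where vw: "{v, w} \<in> E" "?m v = ?m w" by blast
  show thesis
    by (rule that[OF vw(1)]) (use inV[OF vw(1)] orbit_sign_fixed orbit_sign_swap vw(2) in auto)
qed

end

section \<open>Nilpotent quotients of class at least two\<close>

text \<open>
  \<open>X\<close> and \<open>F\<close> are the coordinates of a homomorphism to a Heisenberg-type group over the graph;
  \<open>F g a b\<close> has a meaning only for adjacent \<open>a\<close> and \<open>b\<close>.
\<close>

locale raag_quotient = group N for N (structure) +
  fixes V :: "'a set" and E :: "'a set set" and \<iota> :: "'a \<Rightarrow> 'n"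
    and X :: "'n \<Rightarrow> 'a \<Rightarrow> int" and F :: "'n \<Rightarrow> 'a \<Rightarrow> 'a \<Rightarrow> int"
  assumes graph: "simple_graph V E"
    and \<iota>_closed: "v \<in> V \<Longrightarrow> \<iota> v \<in> carrier N"
    and generated: "carrier N = generate N (\<iota> ` V)"
    and X_mult: "g \<in> carrier N \<Longrightarrow> h \<in> carrier N \<Longrightarrow> X (g \<otimes> h) a = X g a + X h a"
    and F_mult: "g \<in> carrier N \<Longrightarrow> h \<in> carrier N \<Longrightarrow> {a, b} \<in> E \<Longrightarrow>
      F (g \<otimes> h) a b = F g a b + F h a b + X g a * X h b"
    and X_\<iota>: "v \<in> V \<Longrightarrow> X (\<iota> v) a = of_bool (a = v)"
    and F_\<iota>: "v \<in> V \<Longrightarrow> F (\<iota> v) a b = 0"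
    and commute: "v \<in> V \<Longrightarrow> w \<in> V \<Longrightarrow> {v, w} \<notin> E \<Longrightarrow> \<iota> v \<otimes> \<iota> w = \<iota> w \<otimes> \<iota> v"
begin

lemma finite_V: "finite V"
  by (rule simple_graphD(1)[OF graph])

lemma adjacentD: "{v, w} \<in> E \<Longrightarrow> v \<in> V \<and> w \<in> V \<and> v \<noteq> w"
  by (rule simple_graph_edgeD[OF graph])

lemma X_one [simp]: "X \<one> a = 0"
  using X_mult[of \<one> \<one> a] by simp

lemma X_inv: "g \<in> carrier N \<Longrightarrow> X (inv g) a = - X g a"
  using X_mult[of g "inv g" a] by simp

lemma F_one: "{a, b} \<in> E \<Longrightarrow> F \<one> a b = 0"
  using F_mult[of \<one> \<one> a b] by simp

lemma F_inv: "g \<in> carrier N \<Longrightarrow> {a, b} \<in> E \<Longrightarrow> F (inv g) a b = - F g a b + X g a * X g b"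
  using F_mult[of g "inv g" a b] F_one[of a b] by (simp add: X_inv)

lemma X_pow: "g \<in> carrier N \<Longrightarrow> X (g [^] (k :: nat)) a = int k * X g a"
  by (induction k) (simp_all add: X_mult algebra_simps)

lemma X_commutator:
  "g \<in> carrier N \<Longrightarrow> h \<in> carrier N \<Longrightarrow> X (g \<otimes> h \<otimes> inv g \<otimes> inv h) a = 0"
  by (simp add: X_mult X_inv)

lemma F_commutator:
  "g \<in> carrier N \<Longrightarrow> h \<in> carrier N \<Longrightarrow> {a, b} \<in> E \<Longrightarrow>
    F (g \<otimes> h \<otimes> inv g \<otimes> inv h) a b = X g a * X h b - X h a * X g b"
  by (simp add: X_mult X_inv F_mult F_inv algebra_simps)

text \<open>Images of commuting generators commute; comparing \<open>F\<close> of their two products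
  leaves the vanishing minor.\<close>

lemma graph_matrix_endomorphism:
  assumes \<phi>: "\<phi> \<in> hom N N"
  shows "graph_matrix V E (\<lambda>a v. X (\<phi> (\<iota> v)) a)"
  unfolding graph_matrix_def
proof (intro ballI allI impI)
  fix v w x y assume vw: "v \<in> V" "w \<in> V" "{v, w} \<notin> E" and xy: "{x, y} \<in> E"
  have in_N: "\<phi> (\<iota> v) \<in> carrier N" "\<phi> (\<iota> w) \<in> carrier N"
    using vw \<iota>_closed hom_in_carrier[OF \<phi>] by auto
  have "\<phi> (\<iota> v) \<otimes> \<phi> (\<iota> w) = \<phi> (\<iota> w) \<otimes> \<phi> (\<iota> v)"
    using commute[OF vw] vw \<iota>_closed hom_mult[OF \<phi>] by metis
  then have "F (\<phi> (\<iota> v) \<otimes> \<phi> (\<iota> w)) x y = F (\<phi> (\<iota> w) \<otimes> \<phi> (\<iota> v)) x y" by simp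
  then show "X (\<phi> (\<iota> v)) x * X (\<phi> (\<iota> w)) y = X (\<phi> (\<iota> v)) y * X (\<phi> (\<iota> w)) x"
    using F_mult[OF in_N xy] F_mult[OF in_N(2,1) xy] by (simp add: mult.commute)
qed

lemma sum_of_bool_mult [simp]:
  fixes c :: "'a \<Rightarrow> int"
  assumes "u \<in> V"
  shows "(\<Sum>v\<in>V. c v * of_bool (v = u)) = c u" "(\<Sum>v\<in>V. of_bool (v = u) * c v) = c u"
proof -
  have "(\<Sum>v\<in>V. c v * of_bool (v = u)) = (\<Sum>v\<in>V. if v = u then c v else 0)"
    by (intro sum.cong) auto
  then show "(\<Sum>v\<in>V. c v * of_bool (v = u)) = c u"
    using assms finite_V by simp
  then show "(\<Sum>v\<in>V. of_bool (v = u) * c v) = c u"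
    by (simp add: mult.commute)
qed

lemma endomorphism_inv: "\<phi> \<in> hom N N \<Longrightarrow> g \<in> carrier N \<Longrightarrow> \<phi> (inv g) = inv (\<phi> g)"
  by (simp add: group_hom.hom_inv group_hom.intro group_hom_axioms.intro is_group)

lemma endomorphism_one: "\<phi> \<in> hom N N \<Longrightarrow> \<phi> \<one> = \<one>"
  using hom_one is_group by blast

lemma generated_in_carrier: "g \<in> generate N (\<iota> ` V) \<Longrightarrow> g \<in> carrier N"
  using generated by simp

lemma X_endomorphism:
  assumes \<phi>: "\<phi> \<in> hom N N" and "g \<in> carrier N"
  shows "X (\<phi> g) a = (\<Sum>v\<in>V. X (\<phi> (\<iota> v)) a * X g v)"
  using assms(2) unfolding generated
proof (induction g rule: generate.induct)
  case one
  show ?case by (simp add: endomorphism_one[OF \<phi>])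
next
  case (incl g)
  then show ?case by (auto simp: X_\<iota>)
next
  case (inv g)
  then obtain u where u: "u \<in> V" "g = \<iota> u" by blast
  then show ?case
    using \<iota>_closed hom_in_carrier[OF \<phi>]
    by (simp add: endomorphism_inv[OF \<phi>] X_inv X_\<iota> sum_negf)
next
  case (eng g h)
  then show ?case
    using generated_in_carrier hom_in_carrier[OF \<phi>]
    by (simp add: hom_mult[OF \<phi>] X_mult sum.distrib distrib_left)
qed

text \<open>
  \<open>Q\<close> extends \<open>F g\<close> from the edges to all pairs of vertices. It depends on a word for \<open>g\<close>, being
  the cocycle coordinate of that word in the free nilpotent group of class 2.
\<close>

lemma F_endomorphism:
  assumes \<phi>: "\<phi> \<in> hom N N" and "g \<in> carrier N"
  shows "\<exists>Q. (\<forall>v\<in>V. \<forall>w\<in>V. Q v w + Q w v = X g v * X g w - of_bool (v = w) * X g v) \<and>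
    (\<forall>v w. {v, w} \<in> E \<longrightarrow> Q v w = F g v w) \<and>
    (\<forall>a b. {a, b} \<in> E \<longrightarrow> F (\<phi> g) a b = (\<Sum>v\<in>V. F (\<phi> (\<iota> v)) a b * X g v) +
      (\<Sum>v\<in>V. \<Sum>w\<in>V. X (\<phi> (\<iota> v)) a * X (\<phi> (\<iota> w)) b * Q v w))"
  using assms(2) unfolding generated
proof (induction g rule: generate.induct)
  case one
  show ?case
    by (rule exI[of _ "\<lambda>_ _. 0"]) (simp add: F_one endomorphism_one[OF \<phi>])
next
  case (incl g)
  then obtain u where u: "u \<in> V" "g = \<iota> u" by blast
  then show ?case
    by (intro exI[of _ "\<lambda>_ _. 0"]) (auto simp: F_\<iota> X_\<iota>)
next
  case (inv g)
  then obtain u where u: "u \<in> V" "g = \<iota> u" by blast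
  have mem: "\<iota> u \<in> carrier N" "\<phi> (\<iota> u) \<in> carrier N"
    using u(1) \<iota>_closed hom_in_carrier[OF \<phi>] by auto
  have "(\<Sum>v\<in>V. \<Sum>w\<in>V. X (\<phi> (\<iota> v)) a * X (\<phi> (\<iota> w)) b * (of_bool (v = u) * of_bool (w = u))) =
      X (\<phi> (\<iota> u)) a * X (\<phi> (\<iota> u)) b" for a b
  proof -
    have "(\<Sum>v\<in>V. \<Sum>w\<in>V. X (\<phi> (\<iota> v)) a * X (\<phi> (\<iota> w)) b * (of_bool (v = u) * of_bool (w = u))) =
      (\<Sum>v\<in>V. X (\<phi> (\<iota> v)) a * of_bool (v = u)) * (\<Sum>w\<in>V. X (\<phi> (\<iota> w)) b * of_bool (w = u))"
      unfolding sum_product by (intro sum.cong) (auto simp: mult_ac)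
    then show ?thesis using u(1) by simp
  qed
  \<comment> \<open>An inverse generator contributes only at the diagonal position
    \<open>(u, u)\<close>, which is the product term of \<open>F_inv\<close>.\<close>
  then show ?case
    unfolding u(2) using u(1) mem
    by (intro exI[of _ "\<lambda>v w. of_bool (v = u) * of_bool (w = u)"])
      (auto simp: endomorphism_inv[OF \<phi>] X_inv F_inv X_\<iota> F_\<iota> sum_negf)
next
  case (eng g h)
  then obtain Q R where
    Q: "\<forall>v\<in>V. \<forall>w\<in>V. Q v w + Q w v = X g v * X g w - of_bool (v = w) * X g v"
      "\<forall>v w. {v, w} \<in> E \<longrightarrow> Q v w = F g v w"
      "\<forall>a b. {a, b} \<in> E \<longrightarrow> F (\<phi> g) a b = (\<Sum>v\<in>V. F (\<phi> (\<iota> v)) a b * X g v) +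
        (\<Sum>v\<in>V. \<Sum>w\<in>V. X (\<phi> (\<iota> v)) a * X (\<phi> (\<iota> w)) b * Q v w)"
    and R: "\<forall>v\<in>V. \<forall>w\<in>V. R v w + R w v = X h v * X h w - of_bool (v = w) * X h v"
      "\<forall>v w. {v, w} \<in> E \<longrightarrow> R v w = F h v w"
      "\<forall>a b. {a, b} \<in> E \<longrightarrow> F (\<phi> h) a b = (\<Sum>v\<in>V. F (\<phi> (\<iota> v)) a b * X h v) +
        (\<Sum>v\<in>V. \<Sum>w\<in>V. X (\<phi> (\<iota> v)) a * X (\<phi> (\<iota> w)) b * R v w)"
    by blast
  have mem: "g \<in> carrier N" "h \<in> carrier N" "\<phi> g \<in> carrier N" "\<phi> h \<in> carrier N"
    using eng generated_in_carrier hom_in_carrier[OF \<phi>] by auto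
  let ?S = "\<lambda>v w. Q v w + R v w + X g v * X h w"
  have "?S v w + ?S w v = X (g \<otimes> h) v * X (g \<otimes> h) w - of_bool (v = w) * X (g \<otimes> h) v"
    if "v \<in> V" "w \<in> V" for v w
  proof -
    have "?S v w + ?S w v = (Q v w + Q w v) + (R v w + R w v) + X g v * X h w + X g w * X h v"
      by simp
    then show ?thesis
      using Q(1) R(1) that by (simp add: X_mult[OF mem(1,2)] algebra_simps)
  qed
  moreover have "F (\<phi> (g \<otimes> h)) a b = (\<Sum>v\<in>V. F (\<phi> (\<iota> v)) a b * X (g \<otimes> h) v) +
        (\<Sum>v\<in>V. \<Sum>w\<in>V. X (\<phi> (\<iota> v)) a * X (\<phi> (\<iota> w)) b * ?S v w)" if "{a, b} \<in> E" for a b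
  proof -
    have "X (\<phi> g) a * X (\<phi> h) b =
        (\<Sum>v\<in>V. \<Sum>w\<in>V. X (\<phi> (\<iota> v)) a * X (\<phi> (\<iota> w)) b * (X g v * X h w))"
      unfolding X_endomorphism[OF \<phi> mem(1)] X_endomorphism[OF \<phi> mem(2)] sum_product
      by (intro sum.cong) (auto simp: mult_ac)
    then show ?thesis
      using Q(3) R(3) that
      by (simp add: hom_mult[OF \<phi> mem(1,2)] F_mult[OF mem(3,4)] X_mult[OF mem(1,2)]
          distrib_left sum.distrib)
  qed
  ultimately show ?case
    using Q(2) R(2) by (intro exI[of _ ?S]) (simp add: F_mult[OF mem(1,2)])
qed

text \<open>On elements with trivial abelianization \<open>Q\<close> is antisymmetric, so
  \<open>\<phi>\<close> acts through the exterior square of its matrix. The minors of non-adjacent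
  columns vanish, and \<open>f\<close> picks one orientation of each edge.\<close>

lemma F_endomorphism_kernel:
  assumes \<phi>: "\<phi> \<in> hom N N" and g: "g \<in> carrier N" "\<And>v. v \<in> V \<Longrightarrow> X g v = 0"
    and ab: "{a, b} \<in> E" and f: "inj_on f V"
  defines "P \<equiv> {(v, w). {v, w} \<in> E \<and> f v < (f w :: nat)}"
  shows "F (\<phi> g) a b = (\<Sum>(v, w)\<in>P. (X (\<phi> (\<iota> v)) a * X (\<phi> (\<iota> w)) b -
    X (\<phi> (\<iota> v)) b * X (\<phi> (\<iota> w)) a) * F g v w)"
proof -
  let ?A = "\<lambda>a v. X (\<phi> (\<iota> v)) a"
  let ?D = "\<lambda>(v, w). ?A a v * ?A b w - ?A b v * ?A a w"
  obtain Q where Q: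
    "\<forall>v\<in>V. \<forall>w\<in>V. Q v w + Q w v = X g v * X g w - of_bool (v = w) * X g v"
    "\<forall>v w. {v, w} \<in> E \<longrightarrow> Q v w = F g v w"
    "\<forall>a b. {a, b} \<in> E \<longrightarrow> F (\<phi> g) a b = (\<Sum>v\<in>V. F (\<phi> (\<iota> v)) a b * X g v) +
      (\<Sum>v\<in>V. \<Sum>w\<in>V. X (\<phi> (\<iota> v)) a * X (\<phi> (\<iota> w)) b * Q v w)"
    using F_endomorphism[OF \<phi> g(1)] by blast
  have anti: "Q w v = - Q v w" if "v \<in> V" "w \<in> V" for v w
    using Q(1)[rule_format, OF that] g(2) that by simp
  let ?S = "\<Sum>v\<in>V. \<Sum>w\<in>V. ?A a v * ?A b w * Q v w"
  have FS: "F (\<phi> g) a b = ?S"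
    using Q(3) ab g(2) by simp
  \<comment> \<open>Exchanging \<open>v\<close> and \<open>w\<close> turns twice the sum into a sum
    of minors; the factor 2 cancels at the end because each edge occurs in both
    orientations.\<close>
  have "?S = (\<Sum>w\<in>V. \<Sum>v\<in>V. ?A a v * ?A b w * Q v w)"
    by (rule sum.swap)
  also have "\<dots> = - (\<Sum>v\<in>V. \<Sum>w\<in>V. ?A b v * ?A a w * Q v w)"
    unfolding sum_negf[symmetric]
  proof (intro sum.cong HOL.refl)
    fix w v assume "w \<in> V" "v \<in> V"
    then show "?A a v * ?A b w * Q v w = - (?A b w * ?A a v * Q w v)"
      by (subst anti[of v w]) simp_all
  qed
  finally have "2 * ?S = ?S - (\<Sum>v\<in>V. \<Sum>w\<in>V. ?A b v * ?A a w * Q v w)"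
    by simp
  also have "\<dots> = (\<Sum>v\<in>V. \<Sum>w\<in>V. ?D (v, w) * Q v w)"
    by (simp add: sum_subtractf left_diff_distrib)
  also have "\<dots> = (\<Sum>p\<in>V \<times> V. ?D p * case_prod Q p)"
    by (simp add: sum.cartesian_product case_prod_unfold)
  also have "\<dots> = (\<Sum>p\<in>P \<union> prod.swap ` P. ?D p * case_prod Q p)"
  proof (rule sum.mono_neutral_right)
    show "\<forall>p\<in>V \<times> V - (P \<union> prod.swap ` P). ?D p * case_prod Q p = 0"
    proof
      fix p assume p: "p \<in> V \<times> V - (P \<union> prod.swap ` P)"
      obtain v w where vw: "p = (v, w)" by (cases p)
      have "{v, w} \<notin> E"
      proof
        assume e: "{v, w} \<in> E"
        then have "f v \<noteq> f w" using adjacentD[OF e] f by (auto simp: inj_on_def)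
        then have "(v, w) \<in> P \<or> (w, v) \<in> P"
          using e by (auto simp: P_def insert_commute)
        then show False using p vw by force
      qed
      then show "?D p * case_prod Q p = 0"
        using graph_matrix_endomorphism[OF \<phi>] p vw ab unfolding graph_matrix_def by auto
    qed
  qed (use finite_V adjacentD in \<open>auto simp: P_def\<close>)
  also have "\<dots> = (\<Sum>p\<in>P. ?D p * case_prod Q p) + (\<Sum>p\<in>prod.swap ` P. ?D p * case_prod Q p)"
  proof (rule sum.union_disjoint)
    show "finite P"
      by (rule finite_subset[of _ "V \<times> V"]) (use finite_V adjacentD in \<open>auto simp: P_def\<close>)
    then show "finite (prod.swap ` P)" by simp
  qed (auto simp: P_def)
  also have "(\<Sum>p\<in>prod.swap ` P. ?D p * case_prod Q p) = (\<Sum>p\<in>P. ?D p * case_prod Q p)"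
  proof (subst sum.reindex)
    show "sum ((\<lambda>p. ?D p * case_prod Q p) \<circ> prod.swap) P = (\<Sum>p\<in>P. ?D p * case_prod Q p)"
    proof (rule sum.cong)
      fix p assume "p \<in> P"
      then obtain v w where p: "p = (v, w)" "{v, w} \<in> E" by (auto simp: P_def)
      have "Q w v = - Q v w" using anti adjacentD[OF p(2)] by blast
      then show "((\<lambda>p. ?D p * case_prod Q p) \<circ> prod.swap) p = ?D p * case_prod Q p"
        by (simp add: p(1) algebra_simps)
    qed simp
  qed simp
  finally have "?S = (\<Sum>p\<in>P. ?D p * case_prod Q p)" by simp
  also have "\<dots> = (\<Sum>(v, w)\<in>P. ?D (v, w) * F g v w)"
    using Q(2) by (intro sum.cong) (auto simp: P_def)
  finally show ?thesis unfolding FS by (simp add: split_beta)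
qed

end

section \<open>Fixed vectors and invariant edge functionals of a triangular matrix\<close>

context
  fixes V :: "'a set" and E :: "'a set set" and A :: "'a \<Rightarrow> 'a \<Rightarrow> int" and \<theta> :: "'a \<Rightarrow> 'a"
  assumes graph: "simple_graph V E"
    and perm: "\<theta> permutes V"
    and degree_\<theta>: "\<And>v. v \<in> V \<Longrightarrow> degree E (\<theta> v) = degree E v"
    and sign: "\<And>v. v \<in> V \<Longrightarrow> \<bar>A (\<theta> v) v\<bar> = 1"
    and triangular: "\<And>x v. x \<in> V \<Longrightarrow> v \<in> V \<Longrightarrow> A x v \<noteq> 0 \<Longrightarrow> x = \<theta> v \<or> degree E x < degree E v"
begin

text \<open>Take a vertex \<open>u\<close> of maximal degree in the support of \<open>x\<close>.
  Along its orbit the value of \<open>x\<close> changes only by signs, so a return with sign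
  different from \<open>1\<close> forces it to be zero.\<close>

lemma negative_orbits_fixed_vector:
  assumes negative: "\<And>v. v \<in> V \<Longrightarrow> \<exists>k. (\<theta> ^^ k) v = v \<and> orbit_sign (\<lambda>v. A (\<theta> v) v) \<theta> k v \<noteq> 1"
    and fixed: "\<And>u. u \<in> V \<Longrightarrow> (\<Sum>v\<in>V. A u v * x v) = x u" and "v \<in> V"
  shows "x v = 0"
proof (rule ccontr)
  assume "x v \<noteq> 0"
  let ?S = "{v\<in>V. x v \<noteq> 0}"
  note fin = simple_graphD(1)[OF graph]
  have S: "finite (degree E ` ?S)" "degree E ` ?S \<noteq> {}" using fin \<open>v \<in> V\<close> \<open>x v \<noteq> 0\<close> by auto
  then obtain u where u: "u \<in> ?S" "degree E u = Max (degree E ` ?S)"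
    using Max_in[OF S] by force
  have max: "degree E w \<le> degree E u" if "w \<in> V" "x w \<noteq> 0" for w
    unfolding u(2) using that S by (intro Max_ge) auto
  \<comment> \<open>The other nonzero entries of this row belong to vertices of larger degree, where
    \<open>x\<close> vanishes.\<close>
  have step: "x (\<theta> w) = A (\<theta> w) w * x w" if w: "w \<in> V" "degree E w = degree E u" for w
  proof -
    have \<theta>w: "\<theta> w \<in> V" using w(1) permutes_in_image[OF perm] by simp
    have "A (\<theta> w) y * x y = 0" if "y \<in> V - {w}" for y
    proof (rule ccontr)
      assume *: "A (\<theta> w) y * x y \<noteq> 0"
      then have "degree E (\<theta> w) < degree E y"
        using triangular[OF \<theta>w, of y] that permutes_inj[OF perm] by (auto dest: injD)
      then show False using max[of y] * that w degree_\<theta> by auto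
    qed
    then have "(\<Sum>y\<in>V - {w}. A (\<theta> w) y * x y) = 0"
      by (intro sum.neutral) blast
    then show ?thesis
      using fixed[OF \<theta>w] sum.remove[OF fin w(1), of "\<lambda>y. A (\<theta> w) y * x y"] by linarith
  qed
  have orbit: "(\<theta> ^^ k) u \<in> V \<and> degree E ((\<theta> ^^ k) u) = degree E u" for k
    by (induction k) (use u(1) in \<open>auto simp: permutes_in_image[OF perm] degree_\<theta>\<close>)
  have "x ((\<theta> ^^ k) u) = orbit_sign (\<lambda>v. A (\<theta> v) v) \<theta> k u * x u" for k
    by (induction k) (simp_all add: orbit_sign_def step orbit)
  moreover obtain k where "(\<theta> ^^ k) u = u" "orbit_sign (\<lambda>v. A (\<theta> v) v) \<theta> k u \<noteq> 1"
    using negative u(1) by blast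
  ultimately have "x u = orbit_sign (\<lambda>v. A (\<theta> v) v) \<theta> k u * x u" by metis
  then show False using u(1) \<open>orbit_sign _ \<theta> k u \<noteq> 1\<close> by simp
qed

text \<open>\<open>M\<close> is the exterior square of \<open>A\<close> on edges oriented by
  \<open>f\<close>. It is triangular, for the sum of the degrees, over a signed permutation of the
  edges, so \<open>invariant_functional\<close> applies to the orbit of the edge from
  \<open>positive_edge\<close>.\<close>

lemma invariant_edge_functional:
  assumes more: "transposition_free V E" "E \<noteq> {}"
    and aut: "\<And>v w. {\<theta> v, \<theta> w} \<in> E \<longleftrightarrow> {v, w} \<in> E"
    and negative: "\<And>v. v \<in> V \<Longrightarrow> \<exists>k. (\<theta> ^^ k) v = v \<and> orbit_sign (\<lambda>v. A (\<theta> v) v) \<theta> k v \<noteq> 1"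
    and f: "inj_on f V"
  defines "P \<equiv> {(v, w). {v, w} \<in> E \<and> f v < (f w :: nat)}"
    and "M \<equiv> \<lambda>p q. A (fst p) (fst q) * A (snd p) (snd q) - A (snd p) (fst q) * A (fst p) (snd q)"
  shows "\<exists>\<mu>. (\<exists>p\<in>P. \<mu> p \<noteq> 0) \<and> (\<forall>q\<in>P. (\<Sum>p\<in>P. \<mu> p * M p q) = \<mu> q)"
proof -
  let ?s = "\<lambda>v. A (\<theta> v) v"
  note fin = simple_graphD(1)[OF graph]
  have adjD: "v \<in> V \<and> w \<in> V \<and> v \<noteq> w" if "{v, w} \<in> E" for v w
    using that by (rule simple_graph_edgeD[OF graph])
  have f_neq: "f v \<noteq> f w" if "{v, w} \<in> E" for v w
    using adjD[OF that] f by (auto simp: inj_on_def)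
  have \<theta>_eq: "\<theta> v = \<theta> w \<longleftrightarrow> v = w" for v w
    using permutes_inj[OF perm] by (auto dest: injD)
  define orient where "orient x y = (if f x < f y then (x, y) else (y, x))" for x y
  define \<eta> where "\<eta> p = (if p \<in> P then orient (\<theta> (fst p)) (\<theta> (snd p)) else p)" for p
  define t where "t p = ?s (fst p) * ?s (snd p) * (if f (\<theta> (fst p)) < f (\<theta> (snd p)) then 1 else -1)" for p
  have orient_P: "orient x y \<in> P" if "{x, y} \<in> E" for x y
    using that f_neq[OF that] by (auto simp: orient_def P_def insert_commute)
  have \<eta>_in: "\<eta> p \<in> P" if "p \<in> P" for p
  proof -
    have "{fst p, snd p} \<in> E" using that by (auto simp: P_def)
    then show ?thesis using that by (simp add: \<eta>_def orient_P aut)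
  qed
  have P_fin: "finite P"
    by (rule finite_subset[of _ "V \<times> V"]) (use fin adjD in \<open>auto simp: P_def\<close>)
  have "\<eta> permutes P"
  proof (rule inj_imp_permutes)
    show "inj_on \<eta> P"
      by (rule inj_onI) (auto simp: \<eta>_def P_def orient_def \<theta>_eq split: if_splits)
  qed (use P_fin \<eta>_in in \<open>auto simp: \<eta>_def\<close>)
  \<comment> \<open>The crossed product in the leading minor vanishes, which leaves the product of
    the two signs.\<close>
  have A_swap: "A (\<theta> w) v * A (\<theta> v) w = 0" if "{v, w} \<in> E" for v w
  proof (rule ccontr)
    note vw = adjD[OF that]
    assume "A (\<theta> w) v * A (\<theta> v) w \<noteq> 0"
    then have "degree E (\<theta> w) < degree E v" "degree E (\<theta> v) < degree E w"
      using triangular[of "\<theta> w" v] triangular[of "\<theta> v" w] vw \<theta>_eq permutes_in_image[OF perm]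
      by auto
    then show False using vw degree_\<theta> by simp
  qed
  have M_\<eta>: "M (\<eta> p) p = t p" if "p \<in> P" for p
  proof -
    from that obtain v w where p: "p = (v, w)" "{v, w} \<in> E" by (auto simp: P_def)
    show ?thesis
      using that A_swap[OF p(2)] by (auto simp: \<eta>_def M_def t_def p(1) orient_def)
  qed
  obtain v w where vw: "{v, w} \<in> E"
    "\<And>k. (\<theta> ^^ k) v = v \<Longrightarrow> (\<theta> ^^ k) w = w \<Longrightarrow> orbit_sign ?s \<theta> k v * orbit_sign ?s \<theta> k w = 1"
    "\<And>k. (\<theta> ^^ k) v = w \<Longrightarrow> (\<theta> ^^ k) w = v \<Longrightarrow> orbit_sign ?s \<theta> k v * orbit_sign ?s \<theta> k w = -1"
    using positive_edge[OF fin perm sign negative graph more aut] by blast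
  \<comment> \<open>Both sign conditions are symmetric in the ends, so the edge may be oriented
    along \<open>f\<close>.\<close>
  obtain x y where xy: "{x, y} \<in> E" "f x < f y"
    "\<And>k. (\<theta> ^^ k) x = x \<Longrightarrow> (\<theta> ^^ k) y = y \<Longrightarrow> orbit_sign ?s \<theta> k x * orbit_sign ?s \<theta> k y = 1"
    "\<And>k. (\<theta> ^^ k) x = y \<Longrightarrow> (\<theta> ^^ k) y = x \<Longrightarrow> orbit_sign ?s \<theta> k x * orbit_sign ?s \<theta> k y = -1"
  proof (cases "f v < f w")
    case True
    then show thesis using that[OF vw(1)] vw(2,3) by blast
  next
    case False
    then have "f w < f v" using f_neq[OF vw(1)] by simp
    moreover have "{w, v} \<in> E" using vw(1) by (simp add: insert_commute)
    ultimately show thesis using that[of w v] vw(2,3) by (simp add: mult.commute)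
  qed
  have adj_k: "{(\<theta> ^^ k) x, (\<theta> ^^ k) y} \<in> E" for k
    by (induction k) (simp_all add: xy aut)
  have \<eta>_k: "(\<eta> ^^ k) (x, y) = orient ((\<theta> ^^ k) x) ((\<theta> ^^ k) y)" for k
  proof (induction k)
    case (Suc k)
    have "f (\<theta> ((\<theta> ^^ k) x)) \<noteq> f (\<theta> ((\<theta> ^^ k) y))"
      using f_neq[OF adj_k[of "Suc k"]] by simp
    with Suc orient_P[OF adj_k[of k]] show ?case by (auto simp: \<eta>_def orient_def)
  qed (simp add: orient_def xy)
  \<comment> \<open>The reversal signs telescope: only the orientation after \<open>k\<close> steps
    remains.\<close>
  have t_k: "orbit_sign t \<eta> k (x, y) = orbit_sign ?s \<theta> k x * orbit_sign ?s \<theta> k y *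
      (if f ((\<theta> ^^ k) x) < f ((\<theta> ^^ k) y) then 1 else -1)" for k
  proof (induction k)
    case (Suc k)
    have "f (\<theta> ((\<theta> ^^ k) x)) \<noteq> f (\<theta> ((\<theta> ^^ k) y))"
      using f_neq[OF adj_k[of "Suc k"]] by simp
    then have "t ((\<eta> ^^ k) (x, y)) = ?s ((\<theta> ^^ k) x) * ?s ((\<theta> ^^ k) y) *
      (if f ((\<theta> ^^ k) x) < f ((\<theta> ^^ k) y) then 1 else -1) *
      (if f ((\<theta> ^^ Suc k) x) < f ((\<theta> ^^ Suc k) y) then 1 else -1)"
      by (simp add: \<eta>_k t_def orient_def)
    with Suc show ?case by (simp add: orbit_sign_def)
  qed (simp add: orbit_sign_def xy)
  show ?thesis
  proof (rule invariant_functional[OF P_fin \<open>\<eta> permutes P\<close>,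
      where wt = "\<lambda>p. degree E (fst p) + degree E (snd p)" and s = t and i\<^sub>0 = "(x, y)"])
    show "degree E (fst (\<eta> p)) + degree E (snd (\<eta> p)) = degree E (fst p) + degree E (snd p)"
      if "p \<in> P" for p
      using that adjD by (auto simp: \<eta>_def orient_def P_def degree_\<theta>)
    show "M (\<eta> p) p = t p" if "p \<in> P" for p by (rule M_\<eta>[OF that])
    show "q = \<eta> p \<or> degree E (fst q) + degree E (snd q) < degree E (fst p) + degree E (snd p)"
      if pq: "p \<in> P" "q \<in> P" "M q p \<noteq> 0" for p q
    proof -
      obtain v w a b where vw: "p = (v, w)" "{v, w} \<in> E" and ab: "q = (a, b)" "{a, b} \<in> E" "f a < f b"
        using pq(1,2) by (auto simp: P_def)
      note V = adjD[OF vw(2)] adjD[OF ab(2)]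
      have *: "{a, b} = {\<theta> v, \<theta> w} \<or> degree E a + degree E b < degree E v + degree E w"
        if "A a v \<noteq> 0 \<and> A b w \<noteq> 0 \<or> A b v \<noteq> 0 \<and> A a w \<noteq> 0"
        using that triangular[of a v] triangular[of b w] triangular[of b v] triangular[of a w] V
          degree_\<theta>[of v] degree_\<theta>[of w] by (elim disjE conjE) auto
      have "A a v \<noteq> 0 \<and> A b w \<noteq> 0 \<or> A b v \<noteq> 0 \<and> A a w \<noteq> 0"
        using pq(3) by (auto simp: M_def vw(1) ab(1))
      from *[OF this] show ?thesis
        using pq(1) ab(3) by (auto simp: vw(1) ab(1) \<eta>_def orient_def doubleton_eq_iff)
    qed
    show "(x, y) \<in> P" using xy by (simp add: P_def)
    \<comment> \<open>If the return exchanges the ends, the orientation sign cancels the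
      \<open>-1\<close> of \<open>positive_edge\<close>.\<close>
    show "orbit_sign t \<eta> k (x, y) = 1" if "(\<eta> ^^ k) (x, y) = (x, y)" for k
      using that xy(2) xy(3,4)[of k] unfolding t_k \<eta>_k by (auto simp: orient_def split: if_splits)
  qed
qed

end

section \<open>Infinite Reidemeister numbers\<close>

lemma (in group) twisted_conj_refl:
  assumes "\<phi> \<in> hom G G" "x \<in> carrier G"
  shows "(x, x) \<in> twisted_conj G \<phi>"
  using assms hom_one[OF assms(1) is_group is_group]
  by (auto simp: twisted_conj_def intro!: bexI[of _ \<one>])

text \<open>By reflexivity, equal classes of \<open>c k\<close> and \<open>c l\<close> make the two
  elements twisted conjugate, so \<open>sep\<close> applies.\<close>

lemma (in group) reidemeister_number_infinite:
  fixes c :: "nat \<Rightarrow> 'a"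
  assumes \<phi>: "\<phi> \<in> hom G G" and c: "\<And>k. c k \<in> carrier G"
    and sep: "\<And>k l. (c k, c l) \<in> twisted_conj G \<phi> \<Longrightarrow> k = l"
  shows "reidemeister_number G \<phi> = \<infinity>"
proof -
  have "inj (\<lambda>k. twisted_conj G \<phi> `` {c k})"
    using twisted_conj_refl[OF \<phi> c] sep by (intro injI) blast
  moreover have "range (\<lambda>k. twisted_conj G \<phi> `` {c k}) \<subseteq> carrier G // twisted_conj G \<phi>"
    using c by (auto simp: quotient_def)
  ultimately have "infinite (carrier G // twisted_conj G \<phi>)"
    by (metis finite_subset infinite_UNIV_nat range_inj_infinite)
  then show ?thesis by (simp add: reidemeister_number_def)
qed

context raag_quotient
begin

text \<open>In this form, free of inverses, both sides are products to which additive coordinates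
  apply.\<close>

lemma twisted_conjE:
  assumes "\<phi> \<in> hom N N" "(x, y) \<in> twisted_conj N \<phi>"
  obtains z where "z \<in> carrier N" "x \<otimes> \<phi> z = z \<otimes> y" "x \<in> carrier N" "y \<in> carrier N" "\<phi> z \<in> carrier N"
proof -
  from assms(2) obtain z where z: "x \<in> carrier N" "y \<in> carrier N" "z \<in> carrier N"
    "x = z \<otimes> y \<otimes> inv (\<phi> z)"
    unfolding twisted_conj_def by blast
  moreover have "\<phi> z \<in> carrier N" using z hom_in_carrier[OF assms(1)] by simp
  moreover from this have "x \<otimes> \<phi> z = z \<otimes> y" using z by (simp add: m_assoc)
  ultimately show thesis using that by blast
qed

lemma R_infinity_raag_quotient:
  assumes more: "transposition_free V E" "E \<noteq> {}"
  shows "R_infinity N"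
  unfolding R_infinity_def
proof
  fix \<phi> assume "\<phi> \<in> auto N"
  then have \<phi>: "\<phi> \<in> hom N N" and iso: "\<phi> \<in> iso N N"
    by (auto simp: auto_def Bij_def iso_def)
  \<comment> \<open>The inverse automorphism supplies the integer inverse \<open>B\<close> of
    \<open>A\<close>.\<close>
  define \<psi> where "\<psi> = inv_into (carrier N) \<phi>"
  have \<psi>: "\<psi> \<in> hom N N"
    using iso_set_sym[OF iso] by (simp add: \<psi>_def iso_def)
  have bij: "bij_betw \<phi> (carrier N) (carrier N)"
    using iso by (simp add: iso_def)
  have inverse1: "\<phi> (\<psi> g) = g" "\<psi> (\<phi> g) = g" if "g \<in> carrier N" for g
    using that bij unfolding \<psi>_def bij_betw_def by (auto intro: f_inv_into_f inv_into_f_f)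
  define A where "A = (\<lambda>a v. X (\<phi> (\<iota> v)) a)"
  define B where "B = (\<lambda>a v. X (\<psi> (\<iota> v)) a)"
  have matrix: "graph_matrix V E A" "graph_matrix V E B"
    using graph_matrix_endomorphism[OF \<phi>] graph_matrix_endomorphism[OF \<psi>] by (simp_all add: A_def B_def)
  have X_\<phi>: "X (\<phi> g) a = (\<Sum>v\<in>V. A a v * X g v)" if "g \<in> carrier N" for g a
    using X_endomorphism[OF \<phi> that] by (simp add: A_def)
  have inverse: "inverse_matrices V A B"
    unfolding inverse_matrices_def
  proof (intro ballI conjI)
    fix u v assume "u \<in> V" "v \<in> V"
    then have v: "\<iota> v \<in> carrier N" "\<phi> (\<iota> v) \<in> carrier N" "\<psi> (\<iota> v) \<in> carrier N"
      using \<iota>_closed hom_in_carrier[OF \<phi>] hom_in_carrier[OF \<psi>] by auto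
    show "(\<Sum>w\<in>V. A u w * B w v) = of_bool (u = v)"
      using X_endomorphism[OF \<phi> v(3), of u] X_\<iota>[OF \<open>v \<in> V\<close>, of u] inverse1(1)[OF v(1)]
      by (simp add: A_def B_def)
    show "(\<Sum>w\<in>V. B u w * A w v) = of_bool (u = v)"
      using X_endomorphism[OF \<psi> v(2), of u] X_\<iota>[OF \<open>v \<in> V\<close>, of u] inverse1(2)[OF v(1)]
      by (simp add: A_def B_def)
  qed
  obtain \<theta> where \<theta>: "\<theta> permutes V"
    "\<And>v. v \<in> V \<Longrightarrow> degree E (\<theta> v) = degree E v"
    "\<And>v. v \<in> V \<Longrightarrow> \<bar>A (\<theta> v) v\<bar> = 1"
    "\<And>x v. x \<in> V \<Longrightarrow> v \<in> V \<Longrightarrow> A x v \<noteq> 0 \<Longrightarrow> x = \<theta> v \<or> degree E x < degree E v"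
    "\<And>v w. {\<theta> v, \<theta> w} \<in> E \<longleftrightarrow> {v, w} \<in> E"
    by (rule graph_matrix_permutation[OF graph more(1) inverse matrix]) (rule that)
  let ?s = "\<lambda>v. A (\<theta> v) v"
  show "reidemeister_number N \<phi> = \<infinity>"
  proof (cases "\<exists>v\<in>V. \<forall>k. (\<theta> ^^ k) v = v \<longrightarrow> orbit_sign ?s \<theta> k v = 1")
    case True
    then obtain v where "v \<in> V" "\<And>k. (\<theta> ^^ k) v = v \<Longrightarrow> orbit_sign ?s \<theta> k v = 1" by blast
    from invariant_functional[OF finite_V \<theta>(1), where wt = "degree E" and M = A, OF \<theta>(2) HOL.refl \<theta>(4) this]
    obtain \<mu> u where \<mu>: "u \<in> V" "\<mu> u \<noteq> 0" "\<And>i. i \<in> V \<Longrightarrow> (\<Sum>j\<in>V. \<mu> j * A j i) = \<mu> i"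
      by blast
    define L where "L g = (\<Sum>j\<in>V. \<mu> j * X g j)" for g
    have L_mult: "L (g \<otimes> h) = L g + L h" if "g \<in> carrier N" "h \<in> carrier N" for g h
      using that by (simp add: L_def X_mult distrib_left sum.distrib)
    have L_\<phi>: "L (\<phi> g) = L g" if "g \<in> carrier N" for g
    proof -
      have "L (\<phi> g) = (\<Sum>j\<in>V. \<Sum>v\<in>V. \<mu> j * A j v * X g v)"
        by (simp add: L_def X_\<phi>[OF that] sum_distrib_left mult.assoc)
      also have "\<dots> = (\<Sum>v\<in>V. (\<Sum>j\<in>V. \<mu> j * A j v) * X g v)"
        by (subst sum.swap) (simp add: sum_distrib_right)
      finally show ?thesis by (simp add: \<mu>(3) L_def)
    qed
    have L_pow: "L (\<iota> u [^] k) = int k * \<mu> u" for k :: nat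
    proof -
      have "L (\<iota> u [^] k) = (\<Sum>j\<in>V. (int k * \<mu> j) * of_bool (j = u))"
        using \<mu>(1) by (simp add: L_def X_pow \<iota>_closed X_\<iota> mult_ac)
      then show ?thesis using \<mu>(1) by simp
    qed
    show ?thesis
    proof (rule reidemeister_number_infinite[OF \<phi>])
      show "\<iota> u [^] k \<in> carrier N" for k :: nat using \<mu>(1) \<iota>_closed by simp
      fix k l :: nat assume kl: "(\<iota> u [^] k, \<iota> u [^] l) \<in> twisted_conj N \<phi>"
      obtain z where z: "z \<in> carrier N" "\<iota> u [^] k \<otimes> \<phi> z = z \<otimes> \<iota> u [^] l"
        "\<iota> u [^] k \<in> carrier N" "\<iota> u [^] l \<in> carrier N" "\<phi> z \<in> carrier N"
        by (rule twisted_conjE[OF \<phi> kl])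
      have "L (\<iota> u [^] k) + L z = L z + L (\<iota> u [^] l)"
        using arg_cong[OF z(2), of L] L_mult[OF z(3,5)] L_mult[OF z(1,4)] L_\<phi>[OF z(1)] by simp
      then show "k = l" using \<mu>(2) by (simp add: L_pow)
    qed
  next
    case False
    then have negative: "\<And>v. v \<in> V \<Longrightarrow> \<exists>k. (\<theta> ^^ k) v = v \<and> orbit_sign ?s \<theta> k v \<noteq> 1" by blast
    obtain f :: "'a \<Rightarrow> nat" where f: "inj_on f V"
      using finite_imp_inj_to_nat_seg[OF finite_V] by blast
    define P where "P = {(v, w). {v, w} \<in> E \<and> f v < f w}"
    define M where "M = (\<lambda>p q. A (fst p) (fst q) * A (snd p) (snd q) - A (snd p) (fst q) * A (fst p) (snd q))"
    obtain \<mu> p\<^sub>0 where \<mu>: "p\<^sub>0 \<in> P" "\<mu> p\<^sub>0 \<noteq> 0" "\<And>q. q \<in> P \<Longrightarrow> (\<Sum>p\<in>P. \<mu> p * M p q) = \<mu> q"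
      using invariant_edge_functional[where A = A and \<theta> = \<theta>, OF graph \<theta>(1-4) more \<theta>(5) negative f]
      unfolding P_def M_def by blast
    obtain v w where p0: "p\<^sub>0 = (v, w)" by (cases p\<^sub>0)
    have vw: "{v, w} \<in> E" "f v < f w" using \<mu>(1) by (auto simp: P_def p0)
    note V = adjacentD[OF vw(1)]
    have P_fin: "finite P"
      by (rule finite_subset[of _ "V \<times> V"]) (use finite_V adjacentD in \<open>auto simp: P_def\<close>)
    define L where "L g = (\<Sum>p\<in>P. \<mu> p * F g (fst p) (snd p))" for g
    have edge: "{fst p, snd p} \<in> E" if "p \<in> P" for p
      using that by (auto simp: P_def)
    have L_\<phi>: "L (\<phi> g) = L g" if g: "g \<in> carrier N" "\<And>v. v \<in> V \<Longrightarrow> X g v = 0" for g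
    proof -
      have "F (\<phi> g) (fst p) (snd p) = (\<Sum>q\<in>P. M p q * F g (fst q) (snd q))" if "p \<in> P" for p
        using F_endomorphism_kernel[OF \<phi> g edge[OF that] f]
        by (simp add: M_def A_def P_def case_prod_unfold)
      then have "L (\<phi> g) = (\<Sum>p\<in>P. \<Sum>q\<in>P. \<mu> p * M p q * F g (fst q) (snd q))"
        by (simp add: L_def sum_distrib_left mult.assoc)
      also have "\<dots> = (\<Sum>q\<in>P. (\<Sum>p\<in>P. \<mu> p * M p q) * F g (fst q) (snd q))"
        by (subst sum.swap) (simp add: sum_distrib_right)
      finally show ?thesis by (simp add: \<mu>(3) L_def)
    qed
    \<comment> \<open>The product term of \<open>F_mult\<close> vanishes as soon as one factor has
      trivial abelianization.\<close>
    have L_mult: "L (g \<otimes> h) = L g + L h"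
      if "g \<in> carrier N" "h \<in> carrier N" "(\<forall>v\<in>V. X g v = 0) \<or> (\<forall>v\<in>V. X h v = 0)" for g h
    proof -
      have "F (g \<otimes> h) (fst p) (snd p) = F g (fst p) (snd p) + F h (fst p) (snd p)" if "p \<in> P" for p
        using F_mult[OF \<open>g \<in> carrier N\<close> \<open>h \<in> carrier N\<close> edge[OF that]] that
          \<open>_ \<or> _\<close> adjacentD[OF edge[OF that]] by auto
      then show ?thesis by (simp add: L_def distrib_left sum.distrib)
    qed
    define c where "c k = \<iota> v [^] (k :: nat) \<otimes> \<iota> w \<otimes> inv (\<iota> v [^] k) \<otimes> inv (\<iota> w)" for k
    have mem: "\<iota> v [^] (k :: nat) \<in> carrier N" "\<iota> w \<in> carrier N" for k
      using V \<iota>_closed by auto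
    have c: "c k \<in> carrier N" for k using mem by (simp add: c_def)
    have X_c: "X (c k) a = 0" for k a
      unfolding c_def by (rule X_commutator[OF mem])
    have L_c: "L (c k) = int k * \<mu> p\<^sub>0" for k
    proof -
      have "\<mu> p * F (c k) (fst p) (snd p) = (if p = p\<^sub>0 then int k * \<mu> p else 0)" if "p \<in> P" for p
        using that V vw(2) unfolding c_def F_commutator[OF mem edge[OF that]]
        by (cases p) (auto simp: X_pow \<iota>_closed X_\<iota> p0 P_def)
      then show ?thesis using \<mu>(1) P_fin by (simp add: L_def)
    qed
    show ?thesis
    proof (rule reidemeister_number_infinite[OF \<phi> c])
      fix k l :: nat assume kl: "(c k, c l) \<in> twisted_conj N \<phi>"
      obtain z where z: "z \<in> carrier N" "c k \<otimes> \<phi> z = z \<otimes> c l"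
        "c k \<in> carrier N" "c l \<in> carrier N" "\<phi> z \<in> carrier N"
        by (rule twisted_conjE[OF \<phi> kl])
      \<comment> \<open>Both \<open>c k\<close> and \<open>c l\<close> have trivial abelianization,
        so that of \<open>z\<close> is fixed by \<open>A\<close> and therefore zero. This makes
        \<open>L\<close> invariant at \<open>z\<close>.\<close>
      have "X (\<phi> z) a = X z a" for a
        using arg_cong[OF z(2), of "\<lambda>g. X g a"] X_mult[OF z(3,5)] X_mult[OF z(1,4)] by (simp add: X_c)
      then have X_z: "X z a = 0" if "a \<in> V" for a
        using negative_orbits_fixed_vector[where A = A and \<theta> = \<theta>, OF graph \<theta>(1-4) negative _ that, of "X z"] X_\<phi>[OF z(1)]
        by simp
      have "L (c k) + L z = L z + L (c l)"
        using arg_cong[OF z(2), of L] L_mult[OF z(3,5)] L_mult[OF z(1,4)] L_\<phi>[OF z(1) X_z] X_c by simp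
      then show "k = l" using \<mu>(2) by (simp add: L_c)
    qed
  qed
qed

end

section \<open>Presented groups\<close>

context group
begin

primrec eval_word :: "('s \<Rightarrow> 'a) \<Rightarrow> 's word \<Rightarrow> 'a" where
  "eval_word \<iota> [] = \<one>"
| "eval_word \<iota> (x # w) = (if snd x then \<iota> (fst x) else inv (\<iota> (fst x))) \<otimes> eval_word \<iota> w"

lemma eval_word_closed: "\<iota> \<in> S \<rightarrow> carrier G \<Longrightarrow> w \<in> words S \<Longrightarrow> eval_word \<iota> w \<in> carrier G"
  by (induction w) (auto simp: Pi_iff)

lemma eval_word_append:
  "\<iota> \<in> S \<rightarrow> carrier G \<Longrightarrow> u \<in> words S \<Longrightarrow> v \<in> words S \<Longrightarrow>
    eval_word \<iota> (u @ v) = eval_word \<iota> u \<otimes> eval_word \<iota> v"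
  by (induction u) (auto simp: Pi_iff m_assoc eval_word_closed[of _ S])

lemma eval_word_cong:
  assumes \<iota>: "\<iota> \<in> S \<rightarrow> carrier G"
    and R: "\<And>r. r \<in> R \<Longrightarrow> r \<in> words S \<Longrightarrow> eval_word \<iota> r = \<one>"
    and "word_eq S R u v"
  shows "eval_word \<iota> u = eval_word \<iota> v"
  using assms(3)
proof (induction rule: word_eq.induct)
  case (cancel s u v b)
  then have "\<iota> s \<in> carrier G" using \<iota> by auto
  then have "eval_word \<iota> ([(s, b), (s, \<not> b)] @ v) = eval_word \<iota> v"
    using eval_word_closed[OF \<iota> cancel(3)] by (cases b) (simp_all add: m_assoc[symmetric])
  moreover have "eval_word \<iota> (u @ [(s, b), (s, \<not> b)] @ v) = eval_word \<iota> u \<otimes> eval_word \<iota> ([(s, b), (s, \<not> b)] @ v)"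
    using cancel by (intro eval_word_append[OF \<iota>]) auto
  ultimately show ?case using cancel by (simp add: eval_word_append[OF \<iota>])
next
  case (relator r u v)
  then show ?case
    by (simp add: eval_word_append[OF \<iota>] R eval_word_closed[OF \<iota>])
qed auto

lemma presented_group_universal:
  assumes \<iota>: "\<iota> \<in> S \<rightarrow> carrier G"
    and R: "\<And>r. r \<in> R \<Longrightarrow> r \<in> words S \<Longrightarrow> eval_word \<iota> r = \<one>"
  obtains h where "h \<in> hom (presented_group S R) G"
    and "\<And>s. s \<in> S \<Longrightarrow> h (word_class S R [(s, True)]) = \<iota> s"
proof
  define rep where "rep c = (SOME u. u \<in> words S \<and> word_class S R u = c)" for c
  have rep: "eval_word \<iota> (rep (word_class S R u)) = eval_word \<iota> u" if "u \<in> words S" for u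
  proof -
    have "rep (word_class S R u) \<in> words S \<and> word_class S R (rep (word_class S R u)) = word_class S R u"
      unfolding rep_def by (rule someI[of _ u]) (use that in simp)
    then have eq: "word_eq S R (rep (word_class S R u)) u"
      using word_class_eq_iff that by blast
    show ?thesis by (rule eval_word_cong[OF \<iota> _ eq]) (rule R)
  qed
  show "(\<lambda>c. eval_word \<iota> (rep c)) \<in> hom (presented_group S R) G"
    by (rule homI) (auto simp: carrier_presented_group mult_presented_group rep
      eval_word_append[OF \<iota>] eval_word_closed[OF \<iota>])
  show "eval_word \<iota> (rep (word_class S R [(s, True)])) = \<iota> s" if "s \<in> S" for s
    using that \<iota> rep[of "[(s, True)]"] by (auto simp: Pi_iff)
qed

end

lemma inv_presented_group_generator:
  assumes "s \<in> S"
  shows "inv\<^bsub>presented_group S R\<^esub> (word_class S R [(s, True)]) = word_class S R [(s, False)]"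
proof (rule group.inv_equality[OF group_presented_group])
  show "word_class S R [(s, False)] \<otimes>\<^bsub>presented_group S R\<^esub> word_class S R [(s, True)] =
      \<one>\<^bsub>presented_group S R\<^esub>"
    using assms word_eq.cancel[of s S "[]" "[]" R False]
    by (simp add: mult_presented_group one_presented_group word_class_eq_iff)
qed (use assms in \<open>auto simp: carrier_presented_group\<close>)

lemma generate_presented_group:
  "carrier (presented_group S R) =
    generate (presented_group S R) ((\<lambda>s. word_class S R [(s, True)]) ` S)"
proof
  let ?P = "presented_group S R" and ?g = "\<lambda>s. word_class S R [(s, True)]"
  have "word_class S R w \<in> generate ?P (?g ` S)" if "w \<in> words S" for w
    using that
  proof (induction w)
    case Nil
    then show ?case using generate.one[of ?P] by (simp add: one_presented_group)
  next
    case (Cons x w)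
    obtain s b where x: "x = (s, b)" by (cases x)
    have s: "s \<in> S" "w \<in> words S" using Cons.prems by (auto simp: x)
    have "word_class S R [x] \<in> generate ?P (?g ` S)"
      using s(1) generate.incl[of "?g s" "?g ` S" ?P] generate.inv[of "?g s" "?g ` S" ?P]
      by (cases b) (auto simp: x inv_presented_group_generator)
    then have "word_class S R [x] \<otimes>\<^bsub>?P\<^esub> word_class S R w \<in> generate ?P (?g ` S)"
      using Cons.IH[OF s(2)] by (rule generate.eng)
    then show ?case using s by (simp add: mult_presented_group x)
  qed
  then show "carrier ?P \<subseteq> generate ?P (?g ` S)"
    by (auto simp: carrier_presented_group)
  show "generate ?P (?g ` S) \<subseteq> carrier ?P"
    by (rule group.generate_incl[OF group_presented_group]) (auto simp: carrier_presented_group)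
qed

lemma (in group) commutator_eq_one_iff:
  assumes "x \<in> carrier G" "y \<in> carrier G"
  shows "x \<otimes> y \<otimes> inv x \<otimes> inv y = \<one> \<longleftrightarrow> x \<otimes> y = y \<otimes> x"
  using assms by (metis inv_closed inv_equality inv_inv inv_solve_right m_assoc m_closed r_inv l_inv r_one)

section \<open>Generators of the Artin group and a Heisenberg-type representation\<close>

definition raag_gen :: "'a set \<Rightarrow> 'a set set \<Rightarrow> 'a \<Rightarrow> 'a word set" where
  "raag_gen V E v = word_class V
    {[(v, True), (w, True), (v, False), (w, False)] | v w. v \<in> V \<and> w \<in> V \<and> {v, w} \<notin> E} [(v, True)]"

lemma raag_gen_closed: "v \<in> V \<Longrightarrow> raag_gen V E v \<in> carrier (raag V E)"
  by (simp add: raag_gen_def raag_def carrier_presented_group)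

lemma generate_raag: "carrier (raag V E) = generate (raag V E) (raag_gen V E ` V)"
  unfolding raag_def raag_gen_def by (rule generate_presented_group)

lemma raag_gen_commute:
  assumes "v \<in> V" "w \<in> V" "{v, w} \<notin> E"
  shows "raag_gen V E v \<otimes>\<^bsub>raag V E\<^esub> raag_gen V E w = raag_gen V E w \<otimes>\<^bsub>raag V E\<^esub> raag_gen V E v"
proof -
  let ?R = "{[(v, True), (w, True), (v, False), (w, False)] | v w. v \<in> V \<and> w \<in> V \<and> {v, w} \<notin> E}"
  interpret G: group "raag V E" by (rule group_raag)
  have "[(v, True), (w, True), (v, False), (w, False)] \<in> ?R" using assms by blast
  from word_eq.relator[OF this, of V "[]" "[]"]
  have "word_eq V ?R [(v, True), (w, True), (v, False), (w, False)] []" using assms by simp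
  then have "raag_gen V E v \<otimes>\<^bsub>raag V E\<^esub> raag_gen V E w \<otimes>\<^bsub>raag V E\<^esub>
    inv\<^bsub>raag V E\<^esub> (raag_gen V E v) \<otimes>\<^bsub>raag V E\<^esub> inv\<^bsub>raag V E\<^esub> (raag_gen V E w) = \<one>\<^bsub>raag V E\<^esub>"
    using assms unfolding raag_def raag_gen_def
    by (simp add: inv_presented_group_generator mult_presented_group one_presented_group word_class_eq_iff)
  then show ?thesis
    by (rule iffD1[OF G.commutator_eq_one_iff[OF raag_gen_closed raag_gen_closed, OF assms(1,2)]])
qed

text \<open>A central extension of integer vectors by integer matrices. The bilinear cocycle
  \<open>x a * y b\<close> lives on the edges only, so unit vectors of non-adjacent vertices
  commute, and it avoids the halves of an alternating normalization.\<close>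

definition heisenberg :: "'a set set \<Rightarrow> (('a \<Rightarrow> int) \<times> ('a \<Rightarrow> 'a \<Rightarrow> int)) monoid" where
  "heisenberg E = \<lparr>carrier = UNIV,
    monoid.mult = (\<lambda>(x, f) (y, g). (\<lambda>a. x a + y a, \<lambda>a b. f a b + g a b + of_bool ({a, b} \<in> E) * x a * y b)),
    one = (\<lambda>_. 0, \<lambda>_ _. 0)\<rparr>"

lemma heisenberg_simps [simp]:
  "carrier (heisenberg E) = UNIV"
  "(x, f) \<otimes>\<^bsub>heisenberg E\<^esub> (y, g) =
    (\<lambda>a. x a + y a, \<lambda>a b. f a b + g a b + of_bool ({a, b} \<in> E) * x a * y b)"
  "\<one>\<^bsub>heisenberg E\<^esub> = (\<lambda>_. 0, \<lambda>_ _. 0)"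
  by (simp_all add: heisenberg_def)

lemma group_heisenberg: "group (heisenberg E)"
proof (rule groupI)
  fix p :: "('a \<Rightarrow> int) \<times> ('a \<Rightarrow> 'a \<Rightarrow> int)"
  obtain x f where p: "p = (x, f)" by (cases p)
  show "\<exists>q\<in>carrier (heisenberg E). q \<otimes>\<^bsub>heisenberg E\<^esub> p = \<one>\<^bsub>heisenberg E\<^esub>"
    by (rule bexI[of _ "(\<lambda>a. - x a, \<lambda>a b. - f a b + of_bool ({a, b} \<in> E) * x a * x b)"])
      (simp_all add: p)
qed (auto simp: algebra_simps fun_eq_iff)

lemma inv_heisenberg:
  "inv\<^bsub>heisenberg E\<^esub> (x, f) = (\<lambda>a. - x a, \<lambda>a b. - f a b + of_bool ({a, b} \<in> E) * x a * x b)"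
  by (rule group.inv_equality[OF group_heisenberg]) simp_all

lemma raag_heisenberg_hom:
  obtains h where "h \<in> hom (raag V E) (heisenberg E)"
    "\<And>v. v \<in> V \<Longrightarrow> h (raag_gen V E v) = (\<lambda>a. of_bool (a = v), \<lambda>_ _. 0)"
proof -
  interpret H: group "heisenberg E" by (rule group_heisenberg)
  let ?\<iota> = "\<lambda>v. (\<lambda>a. of_bool (a = v) :: int, \<lambda>_ _. 0 :: int)"
  show thesis
  proof (rule H.presented_group_universal[of ?\<iota> V
      "{[(v, True), (w, True), (v, False), (w, False)] | v w. v \<in> V \<and> w \<in> V \<and> {v, w} \<notin> E}"])
    show "H.eval_word ?\<iota> r = \<one>\<^bsub>heisenberg E\<^esub>"
      if "r \<in> {[(v, True), (w, True), (v, False), (w, False)] | v w. v \<in> V \<and> w \<in> V \<and> {v, w} \<notin> E}" for r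
      using that by (auto simp: inv_heisenberg fun_eq_iff of_bool_def insert_commute split: if_splits)
  qed (use that in \<open>auto simp: raag_def raag_gen_def\<close>)
qed

section \<open>Quotients by the lower central series\<close>

context group
begin

text \<open>A conjugate of a commutator is the commutator of the conjugates, so normality passes
  from one term to the next.\<close>

lemma lower_central_normal: "lower_central G (Suc i) \<lhd> G"
proof (induction i)
  case 0
  show ?case by (simp add: normal_self)
next
  case (Suc i)
  then interpret L: normal "lower_central G (Suc i)" G .
  show ?case
    unfolding lower_central.simps
  proof (rule normal_generateI)
    show "{x \<otimes> y \<otimes> inv x \<otimes> inv y |x y. x \<in> carrier G \<and> y \<in> lower_central G (Suc i)} \<subseteq> carrier G"
      using L.subset by auto
    fix h g
    assume "h \<in> {x \<otimes> y \<otimes> inv x \<otimes> inv y |x y. x \<in> carrier G \<and> y \<in> lower_central G (Suc i)}"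
      and g: "g \<in> carrier G"
    then obtain x y where xy: "h = x \<otimes> y \<otimes> inv x \<otimes> inv y" "x \<in> carrier G" "y \<in> lower_central G (Suc i)"
      by blast
    then have y: "y \<in> carrier G" using L.subset by auto
    let ?x = "g \<otimes> x \<otimes> inv g" and ?y = "g \<otimes> y \<otimes> inv g"
    have cancel: "inv g \<otimes> (g \<otimes> z) = z" if "z \<in> carrier G" for z
      using g that by (simp add: m_assoc[symmetric])
    have "g \<otimes> h \<otimes> inv g = ?x \<otimes> ?y \<otimes> inv ?x \<otimes> inv ?y"
      using g xy(2) y by (simp add: xy(1) inv_mult_group m_assoc cancel)
    moreover have "?x \<in> carrier G" "?y \<in> lower_central G (Suc i)"
      using g xy L.inv_op_closed2 by auto
    ultimately show "g \<otimes> h \<otimes> inv g \<in>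
        {x \<otimes> y \<otimes> inv x \<otimes> inv y |x y. x \<in> carrier G \<and> y \<in> lower_central G (Suc i)}"
      by blast
  qed
qed

lemma lower_central_2: "lower_central G (Suc (Suc 0)) = derived G (carrier G)"
  unfolding derived_def lower_central.simps by (rule arg_cong[of _ _ "generate G"]) blast

lemma generate_quotient:
  assumes "H \<lhd> G" "S \<subseteq> carrier G" "carrier G = generate G S"
  shows "carrier (G Mod H) = generate (G Mod H) ((#>) H ` S)"
proof -
  interpret H: normal H G by (rule assms(1))
  interpret hom: group_hom G "G Mod H" "(#>) H"
    using H.r_coset_hom_Mod H.factorgroup_is_group is_group
    by (simp add: group_hom_def group_hom_axioms_def)
  show ?thesis
    using hom.generate_img[OF assms(2)] assms(3) by (simp add: carrier_FactGroup)
qed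

section \<open>Twisted conjugacy in finitely generated abelian groups\<close>

lemma equiv_twisted_conj:
  assumes \<phi>: "\<phi> \<in> hom G G"
  shows "equiv (carrier G) (twisted_conj G \<phi>)"
proof (rule equivI)
  interpret \<phi>: group_hom G G \<phi>
    using \<phi> is_group by (simp add: group_hom_def group_hom_axioms_def)
  show "twisted_conj G \<phi> \<subseteq> carrier G \<times> carrier G"
    by (auto simp: twisted_conj_def)
  show "refl_on (carrier G) (twisted_conj G \<phi>)"
    using twisted_conj_refl[OF \<phi>] by (auto simp: refl_on_def twisted_conj_def)
  show "sym (twisted_conj G \<phi>)"
  proof (rule symI)
    fix x y assume "(x, y) \<in> twisted_conj G \<phi>"
    then obtain z where z: "x \<in> carrier G" "y \<in> carrier G" "z \<in> carrier G" "x = z \<otimes> y \<otimes> inv (\<phi> z)"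
      by (auto simp: twisted_conj_def)
    have "inv z \<otimes> (z \<otimes> y \<otimes> inv (\<phi> z)) \<otimes> inv (\<phi> (inv z)) = (inv z \<otimes> z) \<otimes> y \<otimes> (inv (\<phi> z) \<otimes> \<phi> z)"
      using z(2,3) by (simp add: m_assoc inv_solve_left')
    then have "y = inv z \<otimes> x \<otimes> inv (\<phi> (inv z))"
      using z by simp
    then show "(y, x) \<in> twisted_conj G \<phi>"
      using z by (auto simp: twisted_conj_def simp del: \<phi>.hom_inv intro!: bexI[of _ "inv z"])
  qed
  show "trans (twisted_conj G \<phi>)"
  proof (rule transI)
    fix x y t assume "(x, y) \<in> twisted_conj G \<phi>" "(y, t) \<in> twisted_conj G \<phi>"
    then obtain z w where z: "x \<in> carrier G" "z \<in> carrier G" "x = z \<otimes> y \<otimes> inv (\<phi> z)"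
      and w: "y \<in> carrier G" "t \<in> carrier G" "w \<in> carrier G" "y = w \<otimes> t \<otimes> inv (\<phi> w)"
      by (auto simp: twisted_conj_def)
    have "x = z \<otimes> (w \<otimes> t \<otimes> inv (\<phi> w)) \<otimes> inv (\<phi> z)"
      using z(3) unfolding w(4) .
    also have "\<dots> = (z \<otimes> w) \<otimes> t \<otimes> inv (\<phi> (z \<otimes> w))"
      using z(2) w(2,3) by (simp add: m_assoc inv_mult_group)
    finally show "(x, t) \<in> twisted_conj G \<phi>"
      using z(1,2) w(2,3) unfolding twisted_conj_def by blast
  qed
qed

end

text \<open>The witness is inversion: its twisted conjugacy classes are the cosets of the squares.\<close>

lemma (in comm_group) finitely_generated_not_R_infinity:
  assumes fin: "finite S" and S: "S \<subseteq> carrier G" and gen: "carrier G = generate G S"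
  shows "\<not> R_infinity G"
proof -
  define \<phi> where "\<phi> = (\<lambda>x\<in>carrier G. inv x)"
  have \<phi>: "\<phi> \<in> hom G G"
    by (auto simp: hom_def \<phi>_def inv_mult)
  have "bij_betw \<phi> (carrier G) (carrier G)"
    by (rule bij_betwI[where g = \<phi>]) (auto simp: \<phi>_def)
  then have "\<phi> \<in> auto G"
    using \<phi> by (auto simp: auto_def Bij_def \<phi>_def)
  moreover have "reidemeister_number G \<phi> \<noteq> \<infinity>"
  proof -
    let ?Y = "\<lambda>T. finprod G (\<lambda>x. x) T"
    let ?c = "\<lambda>x. twisted_conj G \<phi> `` {x}"
    have Y_closed: "?Y T \<in> carrier G" if "T \<subseteq> S" for T
      using that S by (intro finprod_closed) auto
    \<comment> \<open>Every element is a square times the product of a subset of the generators; the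
      finitely many subsets bound the number of classes.\<close>
    have "\<exists>T\<subseteq>S. \<exists>z\<in>carrier G. g = z \<otimes> z \<otimes> ?Y T" if "g \<in> carrier G" for g
      using that unfolding gen
    proof (induction g rule: generate.induct)
      case one
      show ?case by (rule exI[of _ "{}"]) (auto intro!: bexI[of _ \<one>] generate.one)
    next
      case (incl s)
      then show ?case using S
        by (intro exI[of _ "{s}"]) (auto intro!: bexI[of _ \<one>] generate.one)
    next
      case (inv s)
      then have "s \<in> carrier G" using S by auto
      then have "inv s = inv s \<otimes> inv s \<otimes> ?Y {s}"
        by (simp add: m_assoc)
      moreover have "inv s \<in> generate G S" using inv by (rule generate.inv)
      ultimately show ?case using inv by (intro exI[of _ "{s}"]) auto
    next
      case (eng g h)
      then obtain T U z w where T: "T \<subseteq> S" "z \<in> carrier G" "g = z \<otimes> z \<otimes> ?Y T"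
        and U: "U \<subseteq> S" "w \<in> carrier G" "h = w \<otimes> w \<otimes> ?Y U"
        unfolding gen[symmetric] by blast
      have split: "?Y T = ?Y (T \<inter> U) \<otimes> ?Y (T - U)" if "T \<subseteq> S" "U \<subseteq> S" for T U
      proof -
        have "?Y ((T \<inter> U) \<union> (T - U)) = ?Y (T \<inter> U) \<otimes> ?Y (T - U)"
          using that S finite_subset[OF _ fin] by (intro finprod_Un_disjoint) auto
        then show ?thesis by (simp add: Int_Diff_Un)
      qed
      have disj: "?Y ((T - U) \<union> (U - T)) = ?Y (T - U) \<otimes> ?Y (U - T)"
        using T(1) U(1) S finite_subset[OF _ fin] by (intro finprod_Un_disjoint) auto
      \<comment> \<open>Generators common to both subsets occur twice and move into the
        square.\<close>
      define y where "y = z \<otimes> w \<otimes> ?Y (T \<inter> U)"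
      have cl: "?Y (T \<inter> U) \<in> carrier G" "?Y (T - U) \<in> carrier G" "?Y (U - T) \<in> carrier G"
        using T(1) U(1) by (auto intro!: Y_closed)
      have "g \<otimes> h = (z \<otimes> z \<otimes> (?Y (T \<inter> U) \<otimes> ?Y (T - U))) \<otimes> (w \<otimes> w \<otimes> (?Y (T \<inter> U) \<otimes> ?Y (U - T)))"
        using T(3) U(3) split[OF T(1) U(1)] split[OF U(1) T(1)] by (simp only: Int_commute)
      also have "\<dots> = y \<otimes> y \<otimes> ?Y ((T - U) \<union> (U - T))"
        unfolding disj y_def using T(2) U(2) cl by (simp add: m_ac)
      finally have "g \<otimes> h = y \<otimes> y \<otimes> ?Y ((T - U) \<union> (U - T))" .
      moreover have "y \<in> carrier G" using T(2) U(2) cl by (simp add: y_def)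
      ultimately show ?case
        using T(1) U(1) unfolding gen[symmetric] by (intro exI[of _ "(T - U) \<union> (U - T)"]) auto
    qed
    then have "?c g \<in> (\<lambda>T. ?c (?Y T)) ` Pow S" if "g \<in> carrier G" for g
    proof -
      from \<open>\<And>g. g \<in> carrier G \<Longrightarrow> _\<close>[OF that]
      obtain T z where T: "T \<subseteq> S" "z \<in> carrier G" "g = z \<otimes> z \<otimes> ?Y T" by blast
      \<comment> \<open>Since \<open>\<phi>\<close> inverts \<open>z\<close>, twisted conjugation of
        \<open>?Y T\<close> by \<open>z\<close> multiplies it by the square of
        \<open>z\<close>.\<close>
      have "g = z \<otimes> ?Y T \<otimes> inv (\<phi> z)"
        using T Y_closed[OF T(1)] by (simp add: \<phi>_def m_ac)
      then have "(g, ?Y T) \<in> twisted_conj G \<phi>"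
        using that T(2) Y_closed[OF T(1)] unfolding twisted_conj_def by blast
      then have "?c g = ?c (?Y T)"
        by (rule equiv_class_eq[OF equiv_twisted_conj[OF \<phi>]])
      then show ?thesis using T(1) by blast
    qed
    then have "carrier G // twisted_conj G \<phi> \<subseteq> (\<lambda>T. ?c (?Y T)) ` Pow S"
      by (auto simp: quotient_def)
    then have "finite (carrier G // twisted_conj G \<phi>)"
      using fin by (meson finite_Pow_iff finite_imageI finite_subset)
    then show ?thesis by (simp add: reidemeister_number_def)
  qed
  ultimately show ?thesis by (auto simp: R_infinity_def)
qed

lemma raag_quotient_not_R_infinity:
  assumes "finite V" "H \<lhd> raag V E" "comm_group (raag V E Mod H)"
  shows "\<not> R_infinity (raag V E Mod H)"
proof -
  interpret G: group "raag V E" by (rule group_raag)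
  have gens: "raag_gen V E ` V \<subseteq> carrier (raag V E)" by (auto intro: raag_gen_closed)
  show ?thesis
  proof (rule comm_group.finitely_generated_not_R_infinity[OF assms(3)])
    show "carrier (raag V E Mod H) = generate (raag V E Mod H) ((#>\<^bsub>raag V E\<^esub>) H ` raag_gen V E ` V)"
      by (rule G.generate_quotient[OF assms(2) gens generate_raag])
  qed (use assms(1) gens in \<open>auto simp: carrier_FactGroup\<close>)
qed

section \<open>The class-two quotient and the nilpotency index\<close>

lemma (in group_hom) generate_subset_kernel:
  assumes "S \<subseteq> kernel G H h"
  shows "generate G S \<subseteq> kernel G H h"
  by (rule G.generate_subgroup_incl[OF assms subgroup_kernel])

text \<open>The Heisenberg homomorphism sends the second term of the series to elements with zero
  vector part, which are central. It therefore kills the third term and factors through the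
  quotient, and its components give \<open>X\<close> and \<open>F\<close>.\<close>

lemma raag_quotient_3:
  assumes "simple_graph V E"
  shows "\<exists>\<iota> X F. raag_quotient (raag V E Mod lower_central (raag V E) 3) V E \<iota> X F"
proof -
  let ?G = "raag V E" and ?L = "lower_central (raag V E)"
  interpret G: group ?G by (rule group_raag)
  obtain h where h: "h \<in> hom ?G (heisenberg E)"
    and h_gen: "\<And>v. v \<in> V \<Longrightarrow> h (raag_gen V E v) = (\<lambda>a. of_bool (a = v), \<lambda>_ _. 0)"
    using raag_heisenberg_hom by blast
  interpret h: group_hom ?G "heisenberg E" h
    using h group_heisenberg group_raag by (simp add: group_hom_def group_hom_axioms_def)
  have inv_fst: "fst (inv\<^bsub>heisenberg E\<^esub> p) = (\<lambda>a. - fst p a)" for p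
    by (cases p) (simp add: inv_heisenberg)
  have mult_fst: "fst (p \<otimes>\<^bsub>heisenberg E\<^esub> q) = (\<lambda>a. fst p a + fst q a)" for p q
    by (cases p; cases q) simp
  have L2: "g \<in> carrier ?G \<and> fst (h g) = (\<lambda>_. 0)" if "g \<in> ?L (Suc (Suc 0))" for g
    using that unfolding lower_central.simps
  proof (induction g rule: generate.induct)
    case (inv g)
    then show ?case by (auto simp: inv_fst mult_fst)
  qed (auto simp: inv_fst mult_fst)
  have "?L (Suc (Suc (Suc 0))) \<subseteq> kernel ?G (heisenberg E) h"
    unfolding lower_central.simps(3)[of _ "Suc 0"]
  proof (intro h.generate_subset_kernel subsetI)
    fix c assume "c \<in> {x \<otimes>\<^bsub>?G\<^esub> y \<otimes>\<^bsub>?G\<^esub> inv\<^bsub>?G\<^esub> x \<otimes>\<^bsub>?G\<^esub> inv\<^bsub>?G\<^esub> y |x y.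
      x \<in> carrier ?G \<and> y \<in> ?L (Suc (Suc 0))}"
    then obtain x y where c: "c = x \<otimes>\<^bsub>?G\<^esub> y \<otimes>\<^bsub>?G\<^esub> inv\<^bsub>?G\<^esub> x \<otimes>\<^bsub>?G\<^esub> inv\<^bsub>?G\<^esub> y"
      "x \<in> carrier ?G" "y \<in> carrier ?G" "fst (h y) = (\<lambda>_. 0)"
      using L2 by blast
    obtain a f where x: "h x = (a, f)" by (cases "h x")
    obtain g where y: "h y = (\<lambda>_. 0, g)" using c(4) by (cases "h y") simp
    have "h c = \<one>\<^bsub>heisenberg E\<^esub>"
      using c(2,3) by (simp add: c(1) x y inv_heisenberg)
    then show "c \<in> kernel ?G (heisenberg E) h"
      using c(2,3) by (simp add: kernel_def c(1))
  qed
  then obtain k where k: "k \<in> hom (?G Mod ?L 3) (heisenberg E)"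
    "\<And>x. x \<in> carrier ?G \<Longrightarrow> k (?L 3 #>\<^bsub>?G\<^esub> x) = h x"
    using h.FactGroup_universal_kernel[OF G.lower_central_normal] by (metis numeral_3_eq_3)
  interpret L: normal "?L 3" ?G
    using G.lower_central_normal[of "Suc (Suc 0)"] by (simp add: numeral_3_eq_3)
  interpret N: group "?G Mod ?L 3" by (rule L.factorgroup_is_group)
  let ?N = "?G Mod ?L 3" and ?\<iota> = "\<lambda>v. ?L 3 #>\<^bsub>?G\<^esub> raag_gen V E v"
  have k_mult: "k (g \<otimes>\<^bsub>?N\<^esub> h) = k g \<otimes>\<^bsub>heisenberg E\<^esub> k h" if "g \<in> carrier ?N" "h \<in> carrier ?N" for g h
    using k(1) that by (rule hom_mult)
  have k_gen: "k (?\<iota> v) = (\<lambda>a. of_bool (a = v), \<lambda>_ _. 0)" if "v \<in> V" for v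
    using that by (simp add: k(2) raag_gen_closed h_gen)
  have mult_snd: "snd (p \<otimes>\<^bsub>heisenberg E\<^esub> q) a b = snd p a b + snd q a b + fst p a * fst q b"
    if "{a, b} \<in> E" for p q a b
    using that by (cases p; cases q) simp
  have "raag_quotient ?N V E ?\<iota> (\<lambda>g. fst (k g)) (\<lambda>g. snd (k g))"
  proof unfold_locales
    show "simple_graph V E" by fact
    show "?\<iota> v \<in> carrier ?N" if "v \<in> V" for v
      using raag_gen_closed[OF that] by (auto simp: carrier_FactGroup)
    have gens: "raag_gen V E ` V \<subseteq> carrier ?G" by (auto intro: raag_gen_closed)
    show "carrier ?N = generate ?N (?\<iota> ` V)"
      using G.generate_quotient[OF L.normal_axioms gens generate_raag] by (simp add: image_image)
    show "?\<iota> v \<otimes>\<^bsub>?N\<^esub> ?\<iota> w = ?\<iota> w \<otimes>\<^bsub>?N\<^esub> ?\<iota> v" if "v \<in> V" "w \<in> V" "{v, w} \<notin> E" for v w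
      using raag_gen_commute[OF that] that by (simp add: L.rcos_sum raag_gen_closed)
    fix g h a assume gh: "g \<in> carrier ?N" "h \<in> carrier ?N"
    show "fst (k (g \<otimes>\<^bsub>?N\<^esub> h)) a = fst (k g) a + fst (k h) a"
      unfolding k_mult[OF gh] mult_fst ..
    show "snd (k (g \<otimes>\<^bsub>?N\<^esub> h)) a b = snd (k g) a b + snd (k h) a b + fst (k g) a * fst (k h) b"
      if "{a, b} \<in> E" for b
      unfolding k_mult[OF gh] mult_snd[OF that] ..
  qed (simp_all only: k_gen fst_conv snd_conv)
  then show ?thesis by blast
qed

theorem theorem1p4:
  fixes V :: "'a set" and E :: "'a set set"
  assumes "simple_graph V E"
    and "E \<noteq> {}"
    and "transposition_free V E"
  shows "R_infinity_nilpotency_index (raag V E) = 2"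
proof -
  let ?G = "raag V E"
  interpret G: group ?G by (rule group_raag)
  have fin: "finite V" by (rule simple_graphD(1)[OF assms(1)])
  \<comment> \<open>At \<open>c = 0\<close> the quotient is by the whole group, hence
    trivial.\<close>
  have "\<not> R_infinity (?G Mod lower_central ?G (0 + 1))"
  proof (rule raag_quotient_not_R_infinity[OF fin])
    show "lower_central ?G (0 + 1) \<lhd> ?G"
      using G.lower_central_normal[of 0] by simp
    then have "group (?G Mod lower_central ?G (0 + 1))"
      by (rule normal.factorgroup_is_group)
    moreover have "carrier (?G Mod carrier ?G) = {carrier ?G}"
      using G.coset_join2[OF _ G.subgroup_self] by (force simp: carrier_FactGroup)
    ultimately show "comm_group (?G Mod lower_central ?G (0 + 1))"
      by (intro group.group_comm_groupI) auto
  qed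
  \<comment> \<open>At \<open>c = 1\<close> the quotient is the abelianization.\<close>
  moreover have "\<not> R_infinity (?G Mod lower_central ?G (1 + 1))"
  proof (rule raag_quotient_not_R_infinity[OF fin])
    show "lower_central ?G (1 + 1) \<lhd> ?G"
      using G.lower_central_normal[of 1] by simp
    show "comm_group (?G Mod lower_central ?G (1 + 1))"
      using G.derived_quot_is_comm_group by (simp add: G.lower_central_2[symmetric])
  qed
  moreover have R2: "R_infinity (?G Mod lower_central ?G (2 + 1))"
    using raag_quotient_3[OF assms(1)] raag_quotient.R_infinity_raag_quotient[OF _ assms(3,2)]
    by fastforce
  ultimately have ge: "2 \<le> c" if "R_infinity (?G Mod lower_central ?G (c + 1))" for c
    using that less_2_cases[of c] by fastforce
  have "(INF c\<in>{c. R_infinity (?G Mod lower_central ?G (c + 1))}. enat c) = enat 2"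
  proof (rule antisym)
    show "(INF c\<in>{c. R_infinity (?G Mod lower_central ?G (c + 1))}. enat c) \<le> enat 2"
      using R2 by (intro INF_lower) simp
    show "enat 2 \<le> (INF c\<in>{c. R_infinity (?G Mod lower_central ?G (c + 1))}. enat c)"
      using ge by (intro INF_greatest) simp
  qed
  then show ?thesis
    by (simp add: R_infinity_nilpotency_index_def numeral_eq_enat)
qed

end
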